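(* There is a sequence $\varepsilon_k\to0$ (not depending on the permutation) such that for every $k\ge1$ and every $\pi\in\Pi_k$, $$\hat\beta(\pi)\le(1+\varepsilon_k)\,\beta(\pi).$$
   Context: $\Pi_k$ is the set of permutations of $[k]=\{1,\dots,k\}$. Let $X_1,X_2,\dots$ be i.i.d. uniform on $[0,1]$. For $\pi\in\Pi_k$, $\mathrm{OA}(\pi)$ is the set of sequences of stopping times $1\le\tau_1<\dots<\tau_k$ with respect to the natural filtration $\sigma(X_1,\dots,X_t)$ such that almost surely $(X_{\tau_1},\dots,X_{\tau_k})$ is order-isomorphic to $\pi$, i.e. $\pi(i)<\pi(j)\Leftrightarrow X_{\tau_i}<X_{\tau_j}$. Define $\beta(\pi):=\inf_{(\tau_1,\dots,\tau_k)\in\mathrm{OA}(\pi)}\mathbb E[\tau_k]$. Finite-host variant: let $\sigma$ be uniform on $\Pi_n$ and let $X_0$ be a random variable (or collection of random variables) independent of $\sigma$, representing internal randomization. A permutation stream embedding of $\pi\in\Pi_k$ in $\sigma$ is a sequence of stopping times $1\le\tau_1\le\dots\le\tau_k\le n+1$ with respect to the sequence $X_0,\sigma(1),\sigma(2),\dots,\sigma(n)$ such that either $\tau_k=n+1$ (failure), or $(\sigma(\tau_j))_{j=1}^k$ is order-isomorphic to $\pi$. $\hat\beta(\pi)$ is the smallest $n$ for which there is a permutation stream embedding of $\pi$ in a uniformly random permutation of length $n$ with $\mathbb P(\tau_k\le n)\ge 1/2$. *)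

theory Defs
  imports "HOL-Probability.Probability" "HOL-Combinatorics.Permutations"
begin

text \<open>
  A permutation of \<open>[k]\<close> is a function \<open>p :: nat \<Rightarrow> nat\<close> with \<open>p permutes {1..k}\<close>.
  Sequences of length \<open>k\<close> are functions on \<open>nat\<close> of which only the arguments \<open>1, \<dots>, k\<close> matter.
\<close>

definition order_isomorphic :: "nat \<Rightarrow> (nat \<Rightarrow> nat) \<Rightarrow> (nat \<Rightarrow> 'b::linorder) \<Rightarrow> bool" where
  "order_isomorphic k p a \<longleftrightarrow>
     (\<forall>i\<in>{1..k}. \<forall>j\<in>{1..k}. p i < p j \<longleftrightarrow> a i < a j)"


subsection \<open>Uniform samples arriving one by one\<close>

definition natural_filtration ::
  "'a measure \<Rightarrow> (nat \<Rightarrow> 'a \<Rightarrow> real) \<Rightarrow> enat \<Rightarrow> 'a measure" where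
  "natural_filtration M X t = sigma (space M)
     (\<Union>s\<in>{s. 1 \<le> s \<and> enat s \<le> t}. {X s -` A \<inter> space M | A. A \<in> sets borel})"

text \<open>
  Stopping times take values in \<open>enat\<close> and are only required to be almost surely finite:
  an everywhere finite version of, say, the first \<open>t\<close> with \<open>X\<^sub>t \<le> 1/2\<close> need not exist.
  The inequalities between them are, as usual, understood almost surely.
\<close>

definition OA ::
  "'a measure \<Rightarrow> (nat \<Rightarrow> 'a \<Rightarrow> real) \<Rightarrow> nat \<Rightarrow> (nat \<Rightarrow> nat) \<Rightarrow> (nat \<Rightarrow> 'a \<Rightarrow> enat) set" where
  "OA M X k p = {\<tau>.
     (\<forall>i\<in>{1..k}. stopping_time (natural_filtration M X) (\<tau> i)) \<and>
     (AE \<omega> in M. 1 \<le> \<tau> 1 \<omega> \<and> (\<forall>i\<in>{1..<k}. \<tau> i \<omega> < \<tau> (Suc i) \<omega>) \<and> \<tau> k \<omega> < \<infinity> \<and>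
        order_isomorphic k p (\<lambda>i. X (the_enat (\<tau> i \<omega>)) \<omega>))}"

text \<open>The canonical i.i.d. uniform sequence on \<open>[0,1]\<close>: the coordinates of a product space.\<close>

definition uniform_seq_space :: "(nat \<Rightarrow> real) measure" where
  "uniform_seq_space = (\<Pi>\<^sub>M t\<in>{1..}. uniform_measure lborel {0..1})"

definition uniform_seq :: "nat \<Rightarrow> (nat \<Rightarrow> real) \<Rightarrow> real" where
  "uniform_seq t \<omega> = \<omega> t"

definition beta :: "nat \<Rightarrow> (nat \<Rightarrow> nat) \<Rightarrow> ennreal" where
  "beta k p = (INF \<tau>\<in>OA uniform_seq_space uniform_seq k p.
     \<integral>\<^sup>+\<omega>. ennreal_of_enat (\<tau> k \<omega>) \<partial>uniform_seq_space)"


subsection \<open>A uniform random permutation as a finite host\<close>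

text \<open>
  The internal randomization \<open>X0\<close> is a countable family of real random variables with arbitrary
  joint law. It is known from time 0 on, and nothing new is revealed after time \<open>n\<close>.
\<close>

definition host_filtration ::
  "'a measure \<Rightarrow> ('a \<Rightarrow> nat \<Rightarrow> real) \<Rightarrow> ('a \<Rightarrow> nat \<Rightarrow> nat) \<Rightarrow> nat \<Rightarrow> nat \<Rightarrow> 'a measure" where
  "host_filtration M X0 \<sigma> n t = sigma (space M)
     ({X0 -` A \<inter> space M | A. A \<in> sets (\<Pi>\<^sub>M i\<in>UNIV. borel)} \<union>
      (\<Union>s\<in>{s. 1 \<le> s \<and> s \<le> t \<and> s \<le> n}. range (\<lambda>j. {\<omega>\<in>space M. \<sigma> \<omega> s = j})))"

text \<open>
  The library notion \<open>indep_var\<close> needs both variables to have the same value type, so independence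
  is stated for the generated \<open>\<sigma>\<close>-algebras.
\<close>

definition random_host ::
  "'a measure \<Rightarrow> ('a \<Rightarrow> nat \<Rightarrow> real) \<Rightarrow> ('a \<Rightarrow> nat \<Rightarrow> nat) \<Rightarrow> nat \<Rightarrow> bool" where
  "random_host M X0 \<sigma> n \<longleftrightarrow>
     prob_space M \<and>
     X0 \<in> measurable M (\<Pi>\<^sub>M i\<in>UNIV. borel) \<and>
     \<sigma> \<in> measurable M (count_space {p. p permutes {1..n}}) \<and>
     prob_space.indep_set M
       (sets (vimage_algebra (space M) X0 (\<Pi>\<^sub>M i\<in>UNIV. borel)))
       (sets (vimage_algebra (space M) \<sigma> (count_space {p. p permutes {1..n}}))) \<and>
     distr M (count_space {p. p permutes {1..n}}) \<sigma> = uniform_count_measure {p. p permutes {1..n}}"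

definition perm_stream_embedding ::
  "'a measure \<Rightarrow> ('a \<Rightarrow> nat \<Rightarrow> real) \<Rightarrow> ('a \<Rightarrow> nat \<Rightarrow> nat) \<Rightarrow> nat \<Rightarrow> nat \<Rightarrow> (nat \<Rightarrow> nat) \<Rightarrow>
     (nat \<Rightarrow> 'a \<Rightarrow> nat) \<Rightarrow> bool" where
  "perm_stream_embedding M X0 \<sigma> n k p \<tau> \<longleftrightarrow>
     (\<forall>i\<in>{1..k}. stopping_time (host_filtration M X0 \<sigma> n) (\<tau> i)) \<and>
     (\<forall>\<omega>\<in>space M. 1 \<le> \<tau> 1 \<omega> \<and> (\<forall>i\<in>{1..<k}. \<tau> i \<omega> \<le> \<tau> (Suc i) \<omega>) \<and> \<tau> k \<omega> \<le> n + 1 \<and>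
        (\<tau> k \<omega> = n + 1 \<or> order_isomorphic k p (\<lambda>j. \<sigma> \<omega> (\<tau> j \<omega>))))"

text \<open>
  A definition cannot quantify over all types of sample spaces; the type chosen here carries
  every joint law of \<open>X0\<close> and \<open>\<sigma>\<close>.
\<close>

definition beta_hat :: "nat \<Rightarrow> (nat \<Rightarrow> nat) \<Rightarrow> nat" where
  "beta_hat k p = (LEAST n. \<exists>(M :: ((nat \<Rightarrow> real) \<times> (nat \<Rightarrow> nat)) measure) X0 \<sigma> \<tau>.
     random_host M X0 \<sigma> n \<and> perm_stream_embedding M X0 \<sigma> n k p \<tau> \<and>
     measure M {\<omega>\<in>space M. \<tau> k \<omega> \<le> n} \<ge> 1 / 2)"

end

theory Submission
  imports Defs "HOL-Real_Asymp.Real_Asymp"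
begin

text \<open>
  Markov's inequality applied to a nearly optimal online algorithm only yields about
  \<open>beta_hat k p \<le> 2 * beta k p\<close>. For the factor \<open>1 + o(1)\<close> one needs an algorithm whose running time is
  concentrated around its mean. Such an algorithm comes from a discretized game with \<open>q\<close> cells,
  where \<open>q\<close> is about \<open>k powr (3/2)\<close>: at every time step a uniform letter \<open>u\<close> from \<open>{1..N}\<close>,
  \<open>N = q + k\<close>, is shown, and it may be used to put the next pattern element, say the \<open>i\<close>-th, into the
  cell \<open>u - p i\<close> of \<open>{1..q}\<close>. Cells of different elements may coincide as long as they are weakly
  ordered as \<open>p\<close> prescribes; the shift by \<open>p i\<close> makes the letters that were used strictly ordered.
  For each element only \<open>k\<close> of the \<open>N\<close> letters point to no cell, which costs a factor \<open>N / q\<close>. In return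
  every partial embedding can be completed, since there is always an admissible cell.

  The game has finitely many positions and so an optimal expected remaining time \<open>cost\<close>,
  determined by backward induction. The following facts give the theorem.

  \<^item> Lower bound: the cells of the values chosen by an online algorithm for real samples are weakly
    ordered, so the algorithm plays the game, with \<open>q\<close> instead of \<open>N\<close> equally likely letters. Whatever
    it does, a step lowers the cost by at most \<open>N / q\<close> on average; hence
    \<open>cost [] \<le> N / q * beta k p\<close> (\<open>cost_le_online_time\<close>).

  \<^item> Concentration: one can always wait for one particular cell, which takes \<open>N\<close> steps on average, so
    a single step never improves the cost by more than \<open>N\<close>. Under optimal play \<open>t + cost\<close> is a
    martingale, and its conditional variance per step is at most \<open>N\<close>. By Chebyshev's inequality the
    game is over with probability at least \<open>1/2\<close> by time \<open>cost [] + sqrt (2 * N * cost []) + 2 * N + 1\<close>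
    (\<open>fail_concentration\<close>).

  \<^item> Size: a first moment count of the embeddings among the first \<open>n\<close> letters shows
    \<open>cost [] \<ge> k\<^sup>2 / 36\<close> (\<open>cost_Nil_ge\<close>). Since \<open>N\<close> is of smaller order than \<open>k\<^sup>2\<close>, the overshoot is
    negligible.

  \<^item> Transfer: if \<open>n\<close> i.i.d. letters are drawn in advance and the \<open>\<sigma> t\<close>-th smallest of them is shown at
    time \<open>t\<close>, the resulting stream is again i.i.d., and smaller letters come with smaller values of \<open>\<sigma>\<close>.
    So the game can be played on a random permutation with internal randomization (\<open>beta_hat_le\<close>).
\<close>

section \<open>Optimal play of the cell game\<close>

text \<open>
  The price \<open>v\<close> at which the gains below \<open>v\<close> add up to \<open>N\<close>. If each outcome \<open>c\<close> occurs with
  probability \<open>1 / N\<close> per step and can be accepted with remaining time \<open>g c\<close>, then \<open>v\<close> is the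
  optimal expected time: it solves \<open>v = 1 + E (min v (g c))\<close>.
\<close>

definition level :: "real \<Rightarrow> 'a set \<Rightarrow> ('a \<Rightarrow> real) \<Rightarrow> real" where
  "level N A g = (SOME v. (\<Sum>c\<in>A. max 0 (v - g c)) = N)"

lemma sum_gains_level:
  assumes "finite A" "A \<noteq> {}" "N \<ge> 0"
  shows "(\<Sum>c\<in>A. max 0 (level N A g - g c)) = N"
proof -
  obtain a where a: "a \<in> A" using assms by blast
  let ?f = "\<lambda>v. \<Sum>c\<in>A. max 0 (v - g c)"
  let ?l = "Min (g ` A)"
  have l: "?l \<le> g c" if "c \<in> A" for c using that assms by simp
  have "?f ?l = 0" using l by (intro sum.neutral) (simp add: max_absorb1)
  moreover have "N \<le> ?f (g a + N)"
    using member_le_sum[of a A "\<lambda>c. max 0 (g a + N - g c)"] a assms by auto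
  moreover have "?l \<le> g a + N" using l[OF a] assms by simp
  moreover have "continuous_on {?l..g a + N} ?f" by (intro continuous_intros)
  ultimately obtain v where "?f v = N" using IVT'[of ?f ?l N "g a + N"] assms by auto
  then show ?thesis unfolding level_def by (rule someI)
qed

locale cell_game =
  fixes p :: "nat \<Rightarrow> nat" and k q :: nat
  assumes perm: "p permutes {1..k}" and k1: "1 \<le> k" and q1: "1 \<le> q"
begin

abbreviation N :: real where "N \<equiv> real (q + k)"

text \<open>
  A position is the list of the cells of the first pattern elements; list index \<open>i\<close> belongs to the
  pattern element \<open>Suc i\<close>.
\<close>

definition consistent :: "nat list \<Rightarrow> bool" where
  "consistent xs \<longleftrightarrow> set xs \<subseteq> {1..q} \<and>
     (\<forall>i<length xs. \<forall>j<length xs. p (Suc i) < p (Suc j) \<longrightarrow> xs ! i \<le> xs ! j)"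

definition extensions :: "nat list \<Rightarrow> nat set" where
  "extensions xs = {c. consistent (xs @ [c])}"

lemma extensions_subset: "extensions xs \<subseteq> {1..q}"
  by (auto simp: extensions_def consistent_def)

lemma finite_extensions [simp]: "finite (extensions xs)"
  using extensions_subset finite_subset by blast

lemma consistent_Nil [simp]: "consistent []"
  by (simp add: consistent_def)

lemma consistent_extend:
  "consistent (xs @ [c]) \<longleftrightarrow> consistent xs \<and> c \<in> {1..q} \<and>
     (\<forall>i<length xs. (p (Suc i) < p (Suc (length xs)) \<longrightarrow> xs ! i \<le> c) \<and>
                    (p (Suc (length xs)) < p (Suc i) \<longrightarrow> c \<le> xs ! i))"
  unfolding consistent_def by (auto simp: nth_append less_Suc_eq)

text \<open>
  Because only a weak order is required, the largest cell among the elements that must lie below the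
  next one is always admissible. There are no dead ends, so all costs are finite.
\<close>

lemma extensions_nonempty:
  assumes "consistent xs" shows "extensions xs \<noteq> {}"
proof -
  let ?n = "length xs"
  let ?B = "insert 1 {xs ! i | i. i < ?n \<and> p (Suc i) < p (Suc ?n)}"
  have fin: "finite ?B" by simp
  have el: "xs ! i \<in> {1..q}" if "i < ?n" for i
    using assms that nth_mem[OF that] unfolding consistent_def by blast
  have "Max ?B \<in> ?B" using Max_in[OF fin] by blast
  then have r: "Max ?B \<in> {1..q}" using el q1 by auto
  have lo: "xs ! i \<le> Max ?B" if "i < ?n" "p (Suc i) < p (Suc ?n)" for i
    using that by (intro Max_ge[OF fin]) auto
  have hi: "Max ?B \<le> xs ! i" if i: "i < ?n" "p (Suc ?n) < p (Suc i)" for i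
  proof (subst Max_le_iff[OF fin])
    show "\<forall>a\<in>?B. a \<le> xs ! i"
    proof
      fix a assume "a \<in> ?B"
      then consider "a = 1" | j where "a = xs ! j" "j < ?n" "p (Suc j) < p (Suc ?n)" by auto
      then show "a \<le> xs ! i"
      proof cases
        case 1 then show ?thesis using el[OF i(1)] by simp
      next
        case 2 then show ?thesis using assms i unfolding consistent_def by (metis order.strict_trans)
      qed
    qed
  qed simp
  have "Max ?B \<in> extensions xs"
    unfolding extensions_def mem_Collect_eq consistent_extend using assms r lo hi by blast
  then show ?thesis by blast
qed

primrec cost_to_go :: "nat \<Rightarrow> nat list \<Rightarrow> real" where
  "cost_to_go 0 xs = 0"
| "cost_to_go (Suc m) xs = level N (extensions xs) (\<lambda>c. cost_to_go m (xs @ [c]))"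

definition cost :: "nat list \<Rightarrow> real" where
  "cost xs = cost_to_go (k - length xs) xs"

definition gain :: "nat list \<Rightarrow> nat \<Rightarrow> real" where
  "gain xs c = max 0 (cost xs - cost (xs @ [c]))"

lemma gain_nonneg: "0 \<le> gain xs c"
  by (simp add: gain_def)

lemma cost_full [simp]: "k \<le> length xs \<Longrightarrow> cost xs = 0"
  by (simp add: cost_def)

lemma sum_gain:
  assumes "consistent xs" "length xs < k"
  shows "(\<Sum>c\<in>extensions xs. gain xs c) = N"
proof -
  obtain m where m: "k - length xs = Suc m" using assms(2) by (cases "k - length xs") auto
  then have "k - length (xs @ [c]) = m" for c by simp
  then show ?thesis
    using sum_gains_level[OF finite_extensions extensions_nonempty[OF assms(1)],
        of N "\<lambda>c. cost_to_go m (xs @ [c])"] m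
    by (simp add: gain_def cost_def)
qed

text \<open>
  Waiting for the single cell \<open>c\<close> takes \<open>N\<close> steps on average. Formally, \<open>N\<close> is the sum of all gains
  and none of them is negative. This bound on the increments is the reason for concentration.
\<close>

lemma gain_le:
  assumes "consistent (xs @ [c])" "length xs < k"
  shows "gain xs c \<le> N"
proof -
  have "consistent xs" using assms(1) by (simp add: consistent_extend)
  moreover have "c \<in> extensions xs" using assms(1) by (simp add: extensions_def)
  then have "gain xs c \<le> (\<Sum>c\<in>extensions xs. gain xs c)"
    by (rule member_le_sum) (simp_all add: gain_nonneg)
  ultimately show ?thesis using sum_gain assms(2) by simp
qed

lemma cost_bounds:
  assumes "consistent xs"
  shows "0 \<le> cost xs \<and> cost xs \<le> N * (k - length xs)"
  using assms
proof (induction "k - length xs" arbitrary: xs)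
  case 0 then show ?case by simp
next
  case (Suc m)
  then have len: "length xs < k" by simp
  have "\<exists>c\<in>extensions xs. gain xs c > 0"
  proof (rule ccontr)
    assume "\<not> ?thesis"
    then have "(\<Sum>c\<in>extensions xs. gain xs c) \<le> 0" by (intro sum_nonpos) (auto simp: not_less)
    then show False using sum_gain[OF Suc.prems len] k1 by simp
  qed
  then obtain c where c: "consistent (xs @ [c])" "gain xs c > 0" by (auto simp: extensions_def)
  have IH: "0 \<le> cost (xs @ [c]) \<and> cost (xs @ [c]) \<le> N * (k - length (xs @ [c]))"
    by (rule Suc.hyps) (use Suc.hyps(2) c in auto)
  have "cost xs > cost (xs @ [c])" using c(2) by (auto simp: gain_def max_def split: if_splits)
  moreover have "cost xs \<le> cost (xs @ [c]) + N"
    using gain_le[OF c(1) len] by (simp add: gain_def)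
  moreover have "real (k - length xs) = real (k - length (xs @ [c])) + 1" using len by simp
  ultimately show ?case using IH by (simp add: algebra_simps)
qed

text \<open>
  Optimal play: a letter is used exactly when this lowers the remaining cost.
\<close>

definition accepts :: "nat list \<Rightarrow> nat \<Rightarrow> bool" where
  "accepts xs u \<longleftrightarrow> length xs < k \<and> p (Suc (length xs)) < u \<and>
     consistent (xs @ [u - p (Suc (length xs))]) \<and> cost (xs @ [u - p (Suc (length xs))]) < cost xs"

definition step :: "nat list \<Rightarrow> nat \<Rightarrow> nat list" where
  "step xs u = (if accepts xs u then xs @ [u - p (Suc (length xs))] else xs)"

lemma step_full [simp]: "k \<le> length xs \<Longrightarrow> step xs u = xs"
  by (simp add: step_def accepts_def)

lemma consistent_step: "consistent xs \<Longrightarrow> consistent (step xs u)"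
  by (simp add: step_def accepts_def)

lemma p_range: "j < k \<Longrightarrow> p (Suc j) \<in> {1..k}"
  using permutes_in_image[OF perm, of "Suc j"] by auto

lemma sum_over_accepted:
  fixes h :: "nat \<Rightarrow> real"
  assumes "consistent xs" "length xs < k"
  shows "(\<Sum>u\<in>{1..q+k}. if accepts xs u then h (u - p (Suc (length xs))) else 0) =
         (\<Sum>c\<in>extensions xs. if cost (xs @ [c]) < cost xs then h c else 0)"
proof -
  let ?s = "p (Suc (length xs))"
  have s: "?s \<le> k" using p_range[OF assms(2)] by simp
  have "(\<Sum>c\<in>extensions xs. if cost (xs @ [c]) < cost xs then h c else 0)
    = (\<Sum>c | c \<in> extensions xs \<and> cost (xs @ [c]) < cost xs. h c)"
    by (subst sum.inter_filter[symmetric]) auto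
  also have "\<dots> = (\<Sum>u | u \<in> {1..q+k} \<and> accepts xs u. h (u - ?s))"
  proof (rule sum.reindex_bij_witness[of _ "\<lambda>u. u - ?s" "\<lambda>c. c + ?s"])
    fix c assume c: "c \<in> {c \<in> extensions xs. cost (xs @ [c]) < cost xs}"
    then have "c \<in> {1..q}" using extensions_subset by blast
    then show "c + ?s \<in> {u \<in> {1..q+k}. accepts xs u}"
      using c s assms by (auto simp: accepts_def extensions_def)
  qed (auto simp: accepts_def extensions_def)
  also have "\<dots> = (\<Sum>u\<in>{1..q+k}. if accepts xs u then h (u - ?s) else 0)"
    by (subst sum.inter_filter[symmetric]) auto
  finally show ?thesis by simp
qed

lemma drop_step: "cost xs - cost (step xs u) =
    (if accepts xs u then gain xs (u - p (Suc (length xs))) else 0)"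
  by (auto simp: step_def gain_def accepts_def)

text \<open>
  One step of optimal play lowers the cost by exactly one on average.
\<close>

lemma sum_drop:
  assumes "consistent xs" "length xs < k"
  shows "(\<Sum>u\<in>{1..q+k}. cost xs - cost (step xs u)) = N"
proof -
  have "(\<Sum>c\<in>extensions xs. if cost (xs @ [c]) < cost xs then gain xs c else 0) = N"
    unfolding sum_gain[OF assms, symmetric] by (intro sum.cong) (auto simp: gain_def)
  then show ?thesis unfolding drop_step using sum_over_accepted[OF assms, of "gain xs"] by simp
qed

lemma drop_bounds:
  "0 \<le> cost xs - cost (step xs u)" "cost xs - cost (step xs u) \<le> N"
  unfolding drop_step using gain_nonneg gain_le by (auto simp: accepts_def)

text \<open>
  The probability that optimal play from the position \<open>xs\<close> is not finished after \<open>n\<close> letters.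
\<close>

primrec fail :: "nat \<Rightarrow> nat list \<Rightarrow> real" where
  "fail 0 xs = of_bool (length xs < k)"
| "fail (Suc n) xs = (\<Sum>u\<in>{1..q+k}. fail n (step xs u)) / N"

lemma N_pos: "N > 0" using k1 by simp

lemma fail_full: "k \<le> length xs \<Longrightarrow> fail n xs = 0"
  by (induction n) auto

lemma fail_bounds: "0 \<le> fail n xs" "fail n xs \<le> 1"
proof (induction n arbitrary: xs)
  case (Suc n)
  { case 1 show ?case using Suc by (auto intro!: divide_nonneg_nonneg sum_nonneg) }
  { case 2
    have "(\<Sum>u\<in>{1..q+k}. fail n (step xs u)) \<le> real (card {1..q+k}) * 1"
      by (rule sum_bounded_above) (rule Suc)
    then show ?case using N_pos by (simp add: divide_le_eq) }
qed auto

text \<open>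
  Chebyshev's inequality for the martingale \<open>t + cost\<close> stopped at the end of the game: its second
  moment around \<open>b\<close> grows by at most \<open>N\<close> per step, and while the game is unfinished at time \<open>n\<close> its
  value is at least \<open>n\<close>, because costs are nonnegative. Moving \<open>b\<close> by one in every step makes this a plain
  induction on \<open>n\<close>.
\<close>

lemma fail_concentration:
  assumes "consistent xs" "b \<le> real n"
  shows "fail n xs * (real n - b)\<^sup>2 \<le> (cost xs - b)\<^sup>2 + N * n"
  using assms
proof (induction n arbitrary: xs b)
  case 0
  then have "0 \<le> cost xs" "b \<le> 0" using cost_bounds by auto
  then have "(0 - b)\<^sup>2 \<le> (cost xs - b)\<^sup>2" by (intro power_mono) auto
  then show ?case by simp
next
  case (Suc n)
  show ?case
  proof (cases "length xs < k")
    case False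
    then show ?thesis using fail_full[of xs "Suc n"] N_pos by (simp del: fail.simps)
  next
    case True
    let ?I = "{1..q+k}"
    define D where "D u = cost xs - cost (step xs u)" for u
    have D: "(\<Sum>u\<in>?I. D u) = N" unfolding D_def by (rule sum_drop[OF Suc.prems(1) True])
    have "(\<Sum>u\<in>?I. (D u)\<^sup>2) \<le> (\<Sum>u\<in>?I. N * D u)"
      unfolding power2_eq_square D_def using drop_bounds by (intro sum_mono mult_right_mono) auto
    also have "\<dots> = N * N" unfolding sum_distrib_left[symmetric] D ..
    finally have D2: "(\<Sum>u\<in>?I. (D u)\<^sup>2) \<le> N * N" .
    \<comment> \<open>Shifting \<open>b\<close> by one compensates the mean drop of one, so that only the variance of the drop is added.\<close>
    have "(\<Sum>u\<in>?I. fail n (step xs u)) * (real (Suc n) - b)\<^sup>2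
        = (\<Sum>u\<in>?I. fail n (step xs u) * (real n - (b - 1))\<^sup>2)"
      unfolding sum_distrib_right by (simp add: algebra_simps)
    also have "\<dots> \<le> (\<Sum>u\<in>?I. (cost (step xs u) - (b - 1))\<^sup>2 + N * n)"
      by (intro sum_mono Suc.IH) (use Suc.prems consistent_step in auto)
    also have "\<dots> = (\<Sum>u\<in>?I. (cost xs - b + 1)\<^sup>2 + N * n - 2 * (cost xs - b + 1) * D u + (D u)\<^sup>2)"
      by (intro sum.cong) (auto simp: D_def power2_eq_square algebra_simps)
    also have "\<dots> = N * ((cost xs - b + 1)\<^sup>2 + N * n) - 2 * (cost xs - b + 1) * (\<Sum>u\<in>?I. D u)
        + (\<Sum>u\<in>?I. (D u)\<^sup>2)"
      by (simp add: sum.distrib sum_subtractf sum_distrib_left)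
    also have "\<dots> \<le> N * ((cost xs - b + 1)\<^sup>2 + N * n) - 2 * (cost xs - b + 1) * N + N * N"
      unfolding D using D2 by linarith
    also have "\<dots> = N * ((cost xs - b)\<^sup>2 + N * Suc n - 1)"
      by (simp add: power2_eq_square algebra_simps)
    also have "\<dots> \<le> N * ((cost xs - b)\<^sup>2 + N * Suc n)"
      using N_pos by (intro mult_left_mono) auto
    finally show ?thesis using N_pos by (simp add: divide_le_eq mult.commute)
  qed
qed

lemma fail_le_half:
  assumes "cost [] \<le> n" "2 * N * n \<le> (n - cost [])\<^sup>2" "n > 0"
  shows "fail n [] \<le> 1 / 2"
proof -
  have *: "fail n [] * (n - cost [])\<^sup>2 \<le> N * n"
    using fail_concentration[of "[]" "cost []" n] assms by simp
  have "fail n [] * (2 * N * n) \<le> fail n [] * (n - cost [])\<^sup>2"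
    using assms fail_bounds by (intro mult_left_mono) auto
  then have "fail n [] * 2 * (N * n) \<le> 1 * (N * n)" using * by (simp add: algebra_simps)
  then show ?thesis using N_pos assms(3) by (subst (asm) mult_le_cancel_right) auto
qed

text \<open>
  The left side is the expected time, truncated at \<open>n\<close>, that optimal play needs.
\<close>

lemma sum_fail_le_cost:
  assumes "consistent xs"
  shows "(\<Sum>m<n. fail m xs) \<le> cost xs"
  using assms
proof (induction n arbitrary: xs)
  case 0 then show ?case using cost_bounds by simp
next
  case (Suc n)
  show ?case
  proof (cases "length xs < k")
    case False
    then show ?thesis by (simp add: fail_full)
  next
    case True
    let ?I = "{1..q+k}"
    have "(\<Sum>m<Suc n. fail m xs) = 1 + (\<Sum>m<n. fail (Suc m) xs)"
      unfolding sum.lessThan_Suc_shift using True by simp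
    also have "(\<Sum>m<n. fail (Suc m) xs) = (\<Sum>u\<in>?I. \<Sum>m<n. fail m (step xs u)) / N"
      by (subst sum.swap) (simp add: sum_divide_distrib)
    also have "\<dots> \<le> (\<Sum>u\<in>?I. cost (step xs u)) / N"
      using N_pos Suc consistent_step by (intro divide_right_mono sum_mono) auto
    also have "(\<Sum>u\<in>?I. cost (step xs u)) = N * cost xs - N"
      using sum_drop[OF Suc.prems True] by (simp add: sum_subtractf)
    finally show ?thesis using N_pos by (simp add: diff_divide_distrib)
  qed
qed

section \<open>The cost is quadratic in the length of the pattern\<close>

definition completions :: "nat list \<Rightarrow> nat list set" where
  "completions xs = {ys. length (xs @ ys) = k \<and> consistent (xs @ ys)}"

lemma finite_completions [simp]: "finite (completions xs)"
proof -
  have "completions xs \<subseteq> {ys. set ys \<subseteq> {1..q} \<and> length ys \<le> k}"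
    by (auto simp: completions_def consistent_def)
  then show ?thesis using finite_lists_length_le[of "{1..q}" k] finite_subset by blast
qed

lemma sum_card_completions_le:
  "(\<Sum>c\<in>extensions xs. card (completions (xs @ [c]))) \<le> card (completions xs)"
proof -
  have "(\<Sum>c\<in>extensions xs. card (completions (xs @ [c])))
      = card (SIGMA c:extensions xs. completions (xs @ [c]))" by simp
  also have "\<dots> \<le> card (completions xs)"
  proof (rule card_inj_on_le[of "\<lambda>(c, ys). c # ys"])
    show "inj_on (\<lambda>(c, ys). c # ys) (SIGMA c:extensions xs. completions (xs @ [c]))"
      by (auto simp: inj_on_def)
    show "(\<lambda>(c, ys). c # ys) ` (SIGMA c:extensions xs. completions (xs @ [c])) \<subseteq> completions xs"
      by (auto simp: completions_def)
  qed simp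
  finally show ?thesis .
qed

lemma completions_full: "consistent xs \<Longrightarrow> length xs = k \<Longrightarrow> completions xs = {[]}"
  by (auto simp: completions_def)

text \<open>
  First moment bound: the right side is the expected number of ways to complete \<open>xs\<close> using some of
  \<open>n\<close> letters, namely the choice of the time steps, times the number of completions, times the
  probability that the chosen letters are the right ones. The induction step is Pascal's rule.
\<close>

lemma success_le_count:
  assumes "consistent xs" "length xs \<le> k"
  shows "1 - fail n xs \<le> (n choose (k - length xs)) * card (completions xs) / N ^ (k - length xs)"
  using assms
proof (induction n arbitrary: xs)
  case 0
  then show ?case using N_pos by (cases "length xs = k") (auto simp: completions_full)
next
  case (Suc n)
  show ?case
  proof (cases "length xs < k")
    case False
    then have "length xs = k" using Suc by simp
    then show ?thesis using Suc fail_full[of xs "Suc n"]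
      by (simp add: completions_full del: fail.simps)
  next
    case True
    then obtain m where m: "k - length xs = Suc m" by (cases "k - length xs") auto
    let ?I = "{1..q+k}" and ?s = "p (Suc (length xs))"
    let ?a = "(n choose Suc m) * card (completions xs) / N ^ Suc m"
    let ?h = "\<lambda>c. (n choose m) * card (completions (xs @ [c])) / N ^ m"
    have h: "0 \<le> ?h c" for c using N_pos by simp
    have "N * (1 - fail (Suc n) xs) = (\<Sum>u\<in>?I. 1 - fail n (step xs u))"
      using N_pos by (simp add: sum_subtractf right_diff_distrib del: of_nat_add)
    also have "\<dots> \<le> (\<Sum>u\<in>?I. ?a + (if accepts xs u then ?h (u - ?s) else 0))"
    proof (rule sum_mono)
      fix u assume "u \<in> ?I"
      show "1 - fail n (step xs u) \<le> ?a + (if accepts xs u then ?h (u - ?s) else 0)"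
      proof (cases "accepts xs u")
        case acc: True
        let ?c = "u - ?s"
        have "k - length (xs @ [?c]) = m" using m by simp
        then have "1 - fail n (xs @ [?c]) \<le> ?h ?c"
          using Suc.IH[of "xs @ [?c]"] acc True by (simp add: accepts_def)
        moreover have "0 \<le> ?a" by (intro divide_nonneg_nonneg mult_nonneg_nonneg) auto
        ultimately show ?thesis unfolding step_def if_P[OF acc] by linarith
      next
        case False
        then show ?thesis using Suc.IH[of xs] Suc.prems m by (simp add: step_def)
      qed
    qed
    also have "\<dots> = N * ?a + (\<Sum>c\<in>extensions xs. if cost (xs @ [c]) < cost xs then ?h c else 0)"
      unfolding sum.distrib sum_over_accepted[OF Suc.prems(1) True, of ?h] by simp
    also have "(\<Sum>c\<in>extensions xs. if cost (xs @ [c]) < cost xs then ?h c else 0)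
        \<le> (\<Sum>c\<in>extensions xs. ?h c)"
      using h by (intro sum_mono) auto
    also have "\<dots> = (n choose m) / N ^ m * (\<Sum>c\<in>extensions xs. card (completions (xs @ [c])))"
      by (simp add: sum_distrib_left)
    also have "\<dots> \<le> (n choose m) / N ^ m * card (completions xs)"
      using sum_card_completions_le[of xs] N_pos
      by (intro mult_left_mono) (auto simp flip: of_nat_sum)
    finally have "N * (1 - fail (Suc n) xs)
      \<le> N * ?a + (n choose m) / N ^ m * card (completions xs)" by simp
    also have "\<dots> = N * ((Suc n choose Suc m) * card (completions xs) / N ^ Suc m)"
    proof -
      have "x * (a * c / x ^ Suc m) + b / x ^ m * c = x * ((b + a) * c / x ^ Suc m)"
        if "x > 0" for x a b c :: real using that by (simp add: field_simps)
      from this[OF N_pos] show ?thesis by simp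
    qed
    finally show ?thesis using N_pos unfolding m by (subst (asm) mult_le_cancel_left_pos) auto
  qed
qed

text \<open>
  After the shift the cells of a complete embedding are \<open>k\<close> different letters, and their order is
  prescribed by \<open>p\<close>; hence the set of these letters determines the embedding.
\<close>

lemma card_completions_Nil: "card (completions []) \<le> (q + k) choose k"
proof -
  let ?r = "inv p"
  have r: "?r s \<in> {1..k}" if "s \<in> {1..k}" for s
    using permutes_in_image[OF permutes_inv[OF perm]] that by blast
  have pr: "p (?r s) = s" for s using permutes_inverses[OF perm] by simp
  \<comment> \<open>The shifted cells, listed by increasing rank in the pattern.\<close>
  define f where "f ys = map (\<lambda>s. ys ! (?r s - 1) + s) [1..<Suc k]" for ys
  have nth: "?r s - 1 < k" "Suc (?r s - 1) = ?r s" if "s \<in> {1..k}" for s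
    using r[OF that] by auto
  have sf: "sorted_wrt (<) (f ys)" "set (f ys) \<subseteq> {1..q+k}" "length (f ys) = k"
    if ys: "ys \<in> completions []" for ys
  proof -
    have len: "length ys = k" and co: "consistent ys" using ys by (auto simp: completions_def)
    have "ys ! (?r s - 1) + s < ys ! (?r t - 1) + t" if "s < t" "s \<in> {1..k}" "t \<in> {1..k}" for s t
    proof -
      have "p (Suc (?r s - 1)) < p (Suc (?r t - 1))" using nth that pr by simp
      then have "ys ! (?r s - 1) \<le> ys ! (?r t - 1)"
        using co nth that len unfolding consistent_def by blast
      then show ?thesis using that by simp
    qed
    then show "sorted_wrt (<) (f ys)"
      unfolding f_def sorted_wrt_map by (intro sorted_wrt_mono_rel[OF _ sorted_wrt_upt]) auto
    have "ys ! (?r s - 1) \<in> {1..q}" if "s \<in> {1..k}" for s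
    proof -
      have "ys ! (?r s - 1) \<in> set ys" using nth(1)[OF that] len by (intro nth_mem) simp
      then show ?thesis using co unfolding consistent_def by blast
    qed
    then show "set (f ys) \<subseteq> {1..q+k}" unfolding f_def by fastforce
    show "length (f ys) = k" by (simp add: f_def)
  qed
  have "card (completions []) \<le> card {B. B \<subseteq> {1..q+k} \<and> card B = k}"
  proof (rule card_inj_on_le[of "\<lambda>ys. set (f ys)"])
    show "inj_on (\<lambda>ys. set (f ys)) (completions [])"
    proof (rule inj_onI)
      fix xs ys assume a: "xs \<in> completions []" "ys \<in> completions []" "set (f xs) = set (f ys)"
      then have eq: "f xs = f ys" using sf by (intro strict_sorted_equal) auto
      show "xs = ys"
      proof (rule nth_equalityI)
        show "length xs = length ys" using a by (simp add: completions_def)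
        fix i assume "i < length xs"
        then have i: "i < k" using a by (simp add: completions_def)
        let ?s = "p (Suc i)"
        have s: "?s \<in> set [1..<Suc k]" using p_range[OF i] by auto
        have r: "?r ?s = Suc i" by (rule permutes_inverses(2)[OF perm])
        have "\<forall>s\<in>set [1..<Suc k]. xs ! (?r s - 1) + s = ys ! (?r s - 1) + s"
          using eq unfolding f_def map_eq_conv .
        from bspec[OF this s] show "xs ! i = ys ! i" unfolding r by simp
      qed
    qed
    show "(\<lambda>ys. set (f ys)) ` completions [] \<subseteq> {B. B \<subseteq> {1..q+k} \<and> card B = k}"
    proof clarify
      fix ys assume ys: "ys \<in> completions []"
      then have "distinct (f ys)" using sf strict_sorted_iff by blast
      then show "set (f ys) \<subseteq> {1..q+k} \<and> card (set (f ys)) = k"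
        using sf[OF ys] distinct_card by metis
    qed
  qed simp
  also have "\<dots> = (q + k) choose k" by (subst n_subsets) auto
  finally show ?thesis .
qed

text \<open>
  A single term of the exponential series at \<open>k\<close>, and \<open>exp 1 \<le> 3\<close>.
\<close>

lemma power_le_fact: "real k ^ k \<le> 3 ^ k * fact k"
proof -
  have "real k ^ k / fact k \<le> (\<Sum>n. real k ^ n / fact n)"
    using sum_le_suminf[of "\<lambda>n. real k ^ n / fact n" "{k}"] summable_exp[of "real k"]
    by (simp add: divide_inverse mult.commute)
  also have "\<dots> = exp (real k)" by (simp add: exp_def divide_inverse mult.commute)
  also have "\<dots> = exp 1 ^ k" by (simp add: exp_of_nat_mult[symmetric])
  also have "\<dots> \<le> 3 ^ k" using exp_le by (intro power_mono) auto
  finally show ?thesis by (simp add: divide_le_eq)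
qed

text \<open>
  The count is at most \<open>n ^ k / (fact k)\<^sup>2\<close>, which is at most \<open>(9 * n / k\<^sup>2) ^ k\<close>.
\<close>

lemma success_le_half:
  assumes "18 * n \<le> k\<^sup>2"
  shows "1 - fail n [] \<le> 1 / 2"
proof -
  have "1 - fail n [] \<le> (n choose k) * card (completions []) / N ^ k"
    using success_le_count[of "[]" n] by simp
  also have "\<dots> \<le> (n choose k) * ((q + k) choose k) / N ^ k"
    using card_completions_Nil by (intro divide_right_mono) (auto intro: mult_left_mono)
  also have "\<dots> \<le> (n choose k) / fact k"
  proof -
    have "real ((q + k choose k) * fact k) \<le> real ((q + k) ^ k)"
      using binomial_fact_pow[of "q+k" k] by (simp only: of_nat_le_iff)
    then have "(q + k choose k) / N ^ k \<le> 1 / fact k" using N_pos by (simp add: field_simps)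
    then have "(n choose k) * ((q + k choose k) / N ^ k) \<le> (n choose k) * (1 / fact k)"
      by (rule mult_left_mono) simp
    then show ?thesis by simp
  qed
  also have "\<dots> \<le> n ^ k / (fact k * fact k)"
  proof -
    have "real ((n choose k) * fact k) \<le> real (n ^ k)"
      using binomial_fact_pow[of n k] by (simp only: of_nat_le_iff)
    then show ?thesis by (simp add: field_simps)
  qed
  also have "\<dots> \<le> 1 / 2"
  proof -
    have "real n ^ k * 18 ^ k = real (18 * n) ^ k" by (simp add: power_mult_distrib)
    also have "\<dots> \<le> real (k\<^sup>2) ^ k" using assms by (intro power_mono) (simp_all only: of_nat_le_iff of_nat_0_le_iff)
    also have "\<dots> = real k ^ k * real k ^ k" by (simp add: power2_eq_square power_mult_distrib)
    also have "\<dots> \<le> (3 ^ k * fact k) * (3 ^ k * fact k)" by (intro mult_mono power_le_fact) auto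
    also have "\<dots> = 9 ^ k * (fact k * fact k)"
      by (simp add: power_mult_distrib[symmetric] mult.commute mult.left_commute)
    finally have "real n ^ k * 18 ^ k \<le> 9 ^ k * (fact k * fact k)" .
    moreover have "(18::real) ^ k = 9 ^ k * 2 ^ k" unfolding power_mult_distrib[symmetric] by simp
    ultimately have "9 ^ k * (real n ^ k * 2 ^ k) \<le> 9 ^ k * (fact k * fact k)"
      by (metis mult.left_commute)
    then have "real n ^ k * 2 ^ k \<le> fact k * fact k" by (subst (asm) mult_le_cancel_left_pos) auto
    moreover have "real n ^ k * 2 \<le> real n ^ k * 2 ^ k"
      using power_increasing[of 1 k "2::real"] k1 by (intro mult_left_mono) auto
    ultimately show ?thesis by (simp add: field_simps)
  qed
  finally show ?thesis .
qed

lemma cost_Nil_ge: "(real k)\<^sup>2 / 36 \<le> cost []"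
proof -
  let ?n = "k\<^sup>2 div 18"
  have "18 * m \<le> k\<^sup>2" if "m < Suc ?n" for m using that by (simp add: less_Suc_eq_le less_eq_div_iff_mult_less_eq)
  then have "1 / 2 \<le> fail m []" if "m < Suc ?n" for m using success_le_half[of m] that by fastforce
  then have "(\<Sum>m<Suc ?n. 1 / 2) \<le> (\<Sum>m<Suc ?n. fail m [])" by (intro sum_mono) auto
  also have "\<dots> \<le> cost []" by (rule sum_fail_le_cost) simp
  finally have "real (Suc ?n) / 2 \<le> cost []" by simp
  moreover have "real (k\<^sup>2) \<le> real (18 * Suc ?n)"
    unfolding of_nat_le_iff using dividend_less_times_div[of 18 "k\<^sup>2"] by simp
  ultimately show ?thesis by simp
qed

end

section \<open>Online algorithms for uniform samples\<close>

lemma strict_chain_less: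
  fixes T :: "nat \<Rightarrow> 'b::order"
  assumes "\<And>i. i \<in> {1..<k} \<Longrightarrow> T i < T (Suc i)" "1 \<le> i" "i < j" "j \<le> k"
  shows "T i < T j"
  using assms(3,4)
proof (induction j rule: less_induct)
  case (less j)
  then obtain j' where j: "j = Suc j'" by (cases j) auto
  show ?case
  proof (cases "i = j'")
    case True then show ?thesis using assms(1)[of i] assms(2) less j by auto
  next
    case False
    then have "T i < T j'" using less j by auto
    also have "T j' < T j" using assms(1)[of j'] assms(2) less j False by auto
    finally show ?thesis .
  qed
qed

context cell_game
begin

text \<open>
  The interval \<open>((c - 1) / q, c / q]\<close> is the cell \<open>c\<close>. The truncation puts also the endpoint \<open>0\<close>, and
  all arguments outside of the unit interval, into a cell, so that the map is total and monotone.
\<close>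

definition cell :: "real \<Rightarrow> nat" where
  "cell x = max 1 (min q (nat \<lceil>real q * x\<rceil>))"

lemma cell_range: "cell x \<in> {1..q}"
  using q1 by (auto simp: cell_def)

lemma cell_mono: "x \<le> y \<Longrightarrow> cell x \<le> cell y"
  unfolding cell_def by (intro max.mono min.mono nat_mono ceiling_mono mult_left_mono) auto

lemma measurable_cell [measurable]: "cell \<in> borel \<rightarrow>\<^sub>M count_space UNIV"
  unfolding cell_def by measurable

lemma cell_cover: "{0..1} \<inter> {x. cell x = c} \<subseteq> {(real c - 1) / q..real c / q}"
proof
  fix x assume "x \<in> {0..1} \<inter> {x. cell x = c}"
  then have x: "0 \<le> x" "x \<le> 1" and c: "cell x = c" by auto
  have q: "real q > 0" "0 \<le> q * x" "q * x \<le> q" using q1 x by (auto simp: mult_le_cancel_left1)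
  have "nat \<lceil>q * x\<rceil> \<le> q" using q by (simp add: ceiling_le_iff nat_le_iff)
  then have c': "c = max 1 (nat \<lceil>q * x\<rceil>)" using c by (simp add: cell_def)
  have "real c - 1 \<le> q * x \<and> q * x \<le> real c"
  proof (cases "\<lceil>q * x\<rceil> \<le> 1")
    case True
    then have "c = 1" using c' by simp
    then show ?thesis using True q by (simp add: ceiling_le_iff)
  next
    case False
    then have "real c = of_int \<lceil>q * x\<rceil>" using c' by simp
    then show ?thesis using ceiling_correct[of "q * x"] by linarith
  qed
  then show "x \<in> {(real c - 1) / q..real c / q}"
    using q by (simp add: field_simps)
qed

end

abbreviation unif :: "real measure" where
  "unif \<equiv> uniform_measure lborel {0..1}"

lemma prob_space_unif: "prob_space unif"
  by (rule prob_space_uniform_measure) auto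

interpretation seq: prob_space uniform_seq_space
  unfolding uniform_seq_space_def by (rule prob_space_PiM) (rule prob_space_unif)

lemma measurable_uniform_seq [measurable]:
  "1 \<le> t \<Longrightarrow> uniform_seq t \<in> borel_measurable uniform_seq_space"
proof -
  assume "1 \<le> t"
  then have "(\<lambda>\<omega>. \<omega> t) \<in> uniform_seq_space \<rightarrow>\<^sub>M unif"
    unfolding uniform_seq_space_def by (intro measurable_component_singleton) auto
  moreover have "(uniform_seq_space \<rightarrow>\<^sub>M unif) = borel_measurable uniform_seq_space"
    by (rule measurable_cong_sets) auto
  ultimately show ?thesis unfolding uniform_seq_def[abs_def] by simp
qed

lemma distr_uniform_seq: "1 \<le> t \<Longrightarrow> distr uniform_seq_space unif (uniform_seq t) = unif"
  unfolding uniform_seq_space_def uniform_seq_def[abs_def]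
  by (rule distr_PiM_component) (auto intro: prob_space_unif)

lemma indep_vars_uniform_seq: "seq.indep_vars (\<lambda>_. unif) uniform_seq {1..}"
proof (subst seq.indep_vars_iff_distr_eq_PiM')
  have r: "(\<lambda>x. \<lambda>i\<in>{1..}. uniform_seq i x) x = x" if "x \<in> space uniform_seq_space" for x
    using that unfolding uniform_seq_space_def uniform_seq_def space_PiM
    by (simp add: PiE_def extensional_restrict)
  have "distr uniform_seq_space (PiM {1..} (\<lambda>_. unif)) (\<lambda>x. \<lambda>i\<in>{1..}. uniform_seq i x)
      = distr uniform_seq_space uniform_seq_space (\<lambda>x. x)"
    by (rule distr_cong[OF refl _ r]) (simp_all only: uniform_seq_space_def)
  also have "\<dots> = uniform_seq_space" by simp
  also have "\<dots> = PiM {1..} (\<lambda>i. distr uniform_seq_space unif (uniform_seq i))"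
  proof -
    have "PiM {1..} (\<lambda>i. distr uniform_seq_space unif (uniform_seq i)) = PiM {1..} (\<lambda>_. unif)"
      by (rule PiM_cong[OF refl]) (simp add: distr_uniform_seq)
    then show ?thesis unfolding uniform_seq_space_def[symmetric] by (rule sym)
  qed
  finally show "distr uniform_seq_space (PiM {1..} (\<lambda>_. unif)) (\<lambda>x. \<lambda>i\<in>{1..}. uniform_seq i x)
     = PiM {1..} (\<lambda>i. distr uniform_seq_space unif (uniform_seq i))" .
  show "uniform_seq i \<in> uniform_seq_space \<rightarrow>\<^sub>M unif" if "i \<in> {1..}" for i
    using measurable_uniform_seq[of i] that
    by (simp add: measurable_cong_sets[of _ uniform_seq_space unif borel])
qed auto

abbreviation past :: "enat \<Rightarrow> (nat \<Rightarrow> real) measure" where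
  "past \<equiv> natural_filtration uniform_seq_space uniform_seq"

lemma space_past [simp]: "space (past t) = space uniform_seq_space"
  unfolding natural_filtration_def by (intro space_measure_of) auto

lemma sets_past: "sets (past t) = sigma_sets (space uniform_seq_space)
    (\<Union>s\<in>{s. 1 \<le> s \<and> enat s \<le> t}. {uniform_seq s -` A \<inter> space uniform_seq_space | A. A \<in> sets borel})"
  unfolding natural_filtration_def by (intro sets_measure_of) auto

lemma sets_past_mono: "t \<le> t' \<Longrightarrow> sets (past t) \<subseteq> sets (past t')"
  unfolding sets_past by (intro sigma_sets_mono') (auto intro: order_trans)

lemma uniform_seq_past:
  "1 \<le> s \<Longrightarrow> enat s \<le> t \<Longrightarrow> A \<in> sets borel \<Longrightarrow>
    uniform_seq s -` A \<inter> space uniform_seq_space \<in> sets (past t)"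
  unfolding sets_past by (intro sigma_sets.Basic) auto

lemma past_subset: "sets (past t) \<subseteq> sets uniform_seq_space"
  unfolding sets_past
  by (rule sets.sigma_sets_subset) (auto intro: measurable_sets[OF measurable_uniform_seq])

text \<open>
  Restatement of independence in the form needed for a one step estimate: the next sample is
  independent of every event of the past.
\<close>

lemma past_indep:
  assumes "B \<in> sets (past (enat t))" "A \<in> sets borel"
  shows "seq.prob (B \<inter> (uniform_seq (Suc t) -` A \<inter> space uniform_seq_space))
       = seq.prob B * measure unif A"
proof -
  let ?E = "\<lambda>i. {uniform_seq i -` A \<inter> space uniform_seq_space | A. A \<in> sets unif}"
  let ?I = "\<lambda>b. if b then {1..t} else {Suc t}"
  have "seq.indep_sets (\<lambda>b. sigma_sets (space uniform_seq_space) (\<Union>i\<in>?I b. ?E i)) UNIV"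
  proof (rule seq.indep_sets_collect_sigma)
    have "seq.indep_sets ?E {1..}"
      using indep_vars_uniform_seq unfolding seq.indep_vars_def2 by blast
    then show "seq.indep_sets ?E (\<Union>b\<in>UNIV. ?I b)"
      by (rule seq.indep_sets_mono_index[rotated]) (auto split: if_splits)
    show "Int_stable (?E i)" for i
    proof (rule Int_stableI)
      fix a b assume "a \<in> ?E i" "b \<in> ?E i"
      then obtain A B where "A \<in> sets unif" "B \<in> sets unif"
        "a = uniform_seq i -` A \<inter> space uniform_seq_space"
        "b = uniform_seq i -` B \<inter> space uniform_seq_space" by blast
      then have "a \<inter> b = uniform_seq i -` (A \<inter> B) \<inter> space uniform_seq_space" "A \<inter> B \<in> sets unif"
        by auto
      then show "a \<inter> b \<in> ?E i" by blast
    qed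
    show "disjoint_family_on ?I UNIV" by (auto simp: disjoint_family_on_def)
  qed
  note indep = this
  have "seq.prob (B \<inter> (uniform_seq (Suc t) -` A \<inter> space uniform_seq_space))
      = seq.prob B * seq.prob (uniform_seq (Suc t) -` A \<inter> space uniform_seq_space)"
  proof -
    have 1: "B \<in> sigma_sets (space uniform_seq_space) (\<Union>i\<in>{1..t}. ?E i)"
      using assms(1) unfolding sets_past by (simp add: atLeastAtMost_def Int_def atLeast_def atMost_def)
    have "uniform_seq (Suc t) -` A \<inter> space uniform_seq_space \<in> ?E (Suc t)"
      using assms(2) by auto
    then have 2: "uniform_seq (Suc t) -` A \<inter> space uniform_seq_space \<in>
        sigma_sets (space uniform_seq_space) (\<Union>i\<in>{Suc t}. ?E i)"
      by (intro sigma_sets.Basic) simp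
    show ?thesis
      using seq.indep_setsD[OF indep, of UNIV
          "\<lambda>b. if b then B else uniform_seq (Suc t) -` A \<inter> space uniform_seq_space"] 1 2
      by (simp add: UNIV_bool Int_ac mult.commute)
  qed
  also have "seq.prob (uniform_seq (Suc t) -` A \<inter> space uniform_seq_space)
     = measure (distr uniform_seq_space unif (uniform_seq (Suc t))) A"
    using assms(2) measurable_uniform_seq[of "Suc t"]
    by (subst measure_distr) (simp_all add: measurable_cong_sets[of _ uniform_seq_space unif borel])
  finally show ?thesis by (simp add: distr_uniform_seq)
qed

lemma takeWhile_map_measurable:
  assumes "\<And>i c. i \<in> set is \<Longrightarrow> {\<omega>\<in>space M. m i \<omega> = c} \<in> sets M"
  shows "{\<omega>\<in>space M. takeWhile (\<lambda>c. c \<noteq> 0) (map (\<lambda>i. m i \<omega>) is) = xs} \<in> sets M"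
  using assms
proof (induction "is" arbitrary: xs)
  case Nil then show ?case by (cases xs) auto
next
  case (Cons i "is")
  note m = Cons.prems[OF list.set_intros(1)]
  have IH: "{\<omega>\<in>space M. takeWhile (\<lambda>c. c \<noteq> 0) (map (\<lambda>i. m i \<omega>) is) = ys} \<in> sets M" for ys
    by (rule Cons.IH) (rule Cons.prems, simp)
  show ?case
  proof (cases xs)
    case [simp]: Nil
    have "{\<omega>\<in>space M. takeWhile (\<lambda>c. c \<noteq> 0) (map (\<lambda>i. m i \<omega>) (i # is)) = xs}
      = {\<omega>\<in>space M. m i \<omega> = 0}" by auto
    then show ?thesis using m by simp
  next
    case [simp]: (Cons y ys)
    have "{\<omega>\<in>space M. takeWhile (\<lambda>c. c \<noteq> 0) (map (\<lambda>i. m i \<omega>) (i # is)) = xs}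
      = (if y = 0 then {} else {\<omega>\<in>space M. m i \<omega> = y} \<inter>
          {\<omega>\<in>space M. takeWhile (\<lambda>c. c \<noteq> 0) (map (\<lambda>i. m i \<omega>) is) = ys})"
      by auto
    then show ?thesis using m IH by simp
  qed
qed

context cell_game
begin

lemma measure_cell_le: "measure unif {x. cell x = c} \<le> 1 / q"
proof -
  have [measurable]: "{x. cell x = c} \<in> sets borel"
    using measurable_sets[OF measurable_cell, of "{c}"] by (simp add: vimage_def)
  have "measure unif {x. cell x = c} = measure lborel ({0..1} \<inter> {x. cell x = c})"
    by (subst measure_uniform_measure) auto
  also have "\<dots> \<le> measure lborel {(real c - 1) / q..real c / q}"
    by (intro measure_mono_fmeasurable cell_cover fmeasurableI) (auto simp: emeasure_lborel_Icc_eq)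
  also have "\<dots> = 1 / q" using q1 by (simp add: diff_divide_distrib[symmetric] divide_right_mono)
  finally show ?thesis .
qed

text \<open>
  The position of the cell game that an online algorithm \<open>\<tau>\<close> has reached at time \<open>t\<close>. The value \<open>0\<close> marks
  an element that is not yet placed; it is not a cell. Positions are cut at the first such element, so
  that they make sense also on the null set where \<open>\<tau>\<close> is not increasing.
\<close>

definition placed :: "(nat \<Rightarrow> (nat \<Rightarrow> real) \<Rightarrow> enat) \<Rightarrow> nat \<Rightarrow> (nat \<Rightarrow> real) \<Rightarrow> nat list" where
  "placed \<tau> t \<omega> = takeWhile (\<lambda>c. c \<noteq> 0)
     (map (\<lambda>i. if 1 \<le> \<tau> i \<omega> \<and> \<tau> i \<omega> \<le> enat t then cell (\<omega> (the_enat (\<tau> i \<omega>))) else 0) [1..<Suc k])"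

lemma placed_0: "placed \<tau> 0 \<omega> = []"
proof -
  have "\<not> (1 \<le> \<tau> i \<omega> \<and> \<tau> i \<omega> \<le> enat 0)" for i
    by (cases "\<tau> i \<omega>") (auto simp: one_enat_def)
  then have "placed \<tau> 0 \<omega> = takeWhile (\<lambda>c. c \<noteq> 0) (map (\<lambda>_. 0) [1..<Suc k])"
    unfolding placed_def by (simp only: if_False)
  then show ?thesis by (cases "[1..<Suc k]") auto
qed

text \<open>
  Only finitely many events of the form \<open>\<tau> i = s\<close> with \<open>s \<le> t\<close>, together with the cell of the sample
  at time \<open>s\<close>, enter into the position at time \<open>t\<close>.
\<close>

lemma placed_measurable:
  assumes "\<And>i. i \<in> {1..k} \<Longrightarrow> stopping_time past (\<tau> i)"
  shows "{\<omega>\<in>space uniform_seq_space. placed \<tau> t \<omega> = xs} \<in> sets (past (enat t))"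
proof -
  let ?U = "uniform_seq_space"
  let ?m = "\<lambda>i \<omega>. if 1 \<le> \<tau> i \<omega> \<and> \<tau> i \<omega> \<le> enat t then cell (\<omega> (the_enat (\<tau> i \<omega>))) else 0"
  have le: "{\<omega>\<in>space ?U. \<tau> i \<omega> \<le> enat s} \<in> sets (past (enat s'))"
    if "i \<in> {1..k}" "s \<le> s'" for i s s'
  proof -
    have "{\<omega>\<in>space ?U. \<tau> i \<omega> \<le> enat s} \<in> sets (past (enat s))"
      using stopping_timeD[OF assms[OF that(1)], of "enat s"] by (simp add: pred_def)
    then show ?thesis using sets_past_mono[of "enat s" "enat s'"] that by auto
  qed
  have "{\<omega>\<in>space (past (enat t)). ?m i \<omega> = c} \<in> sets (past (enat t))" if i: "i \<in> set [1..<Suc k]" for i c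
  proof -
    have i': "i \<in> {1..k}" using i by auto
    let ?H = "\<lambda>s c. ({\<omega>\<in>space ?U. \<tau> i \<omega> \<le> enat s} - {\<omega>\<in>space ?U. \<tau> i \<omega> \<le> enat (s - 1)})
        \<inter> (uniform_seq s -` {x. cell x = c} \<inter> space ?U)"
    have H: "?H s c \<in> sets (past (enat t))" if "s \<in> {1..t}" for s c
    proof -
      have "{x. cell x = c} \<in> sets borel"
        using measurable_sets[OF measurable_cell, of "{c}"] by (simp add: vimage_def)
      then show ?thesis using that
        by (intro sets.Int sets.Diff le i' uniform_seq_past) auto
    qed
    have pos: "{\<omega>\<in>space ?U. ?m i \<omega> = c} = (\<Union>s\<in>{1..t}. ?H s c)" if "c \<noteq> 0" for c
    proof (intro equalityI subsetI)
      fix \<omega> assume w: "\<omega> \<in> {\<omega>\<in>space ?U. ?m i \<omega> = c}"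
      then obtain s where s: "\<tau> i \<omega> = enat s" "1 \<le> s" "s \<le> t"
        using \<open>c \<noteq> 0\<close> by (cases "\<tau> i \<omega>") (auto simp: one_enat_def split: if_splits)
      then show "\<omega> \<in> (\<Union>s\<in>{1..t}. ?H s c)" using w by (auto simp: one_enat_def uniform_seq_def)
    next
      fix \<omega> assume "\<omega> \<in> (\<Union>s\<in>{1..t}. ?H s c)"
      then obtain s where s: "s \<in> {1..t}" "\<omega> \<in> ?H s c" by blast
      then have "\<tau> i \<omega> = enat s" by (cases "\<tau> i \<omega>") auto
      then show "\<omega> \<in> {\<omega>\<in>space ?U. ?m i \<omega> = c}" using s by (auto simp: one_enat_def uniform_seq_def)
    qed
    show ?thesis
    proof (cases "c = 0")
      case False then show ?thesis using pos[OF False] H by auto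
    next
      case True
      have "{\<omega>\<in>space ?U. ?m i \<omega> = c} = space (past (enat t)) - (\<Union>c\<in>{1..q}. {\<omega>\<in>space ?U. ?m i \<omega> = c})"
        using True cell_range by auto
      also have "\<dots> = space (past (enat t)) - (\<Union>c\<in>{1..q}. (\<Union>s\<in>{1..t}. ?H s c))"
        using pos by (intro arg_cong2[of _ _ _ _ minus] refl SUP_cong) auto
      also have "\<dots> \<in> sets (past (enat t))"
        using H by (intro sets.Diff sets.top sets.finite_UN) auto
      finally show ?thesis by simp
    qed
  qed
  from takeWhile_map_measurable[of "[1..<Suc k]" "past (enat t)" ?m, OF this] show ?thesis
    unfolding placed_def by simp
qed

text \<open>
  The almost sure requirements on an online algorithm, for a single outcome.
\<close>

definition valid_run :: "(nat \<Rightarrow> (nat \<Rightarrow> real) \<Rightarrow> enat) \<Rightarrow> (nat \<Rightarrow> real) \<Rightarrow> bool" where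
  "valid_run \<tau> \<omega> \<longleftrightarrow> 1 \<le> \<tau> 1 \<omega> \<and> (\<forall>i\<in>{1..<k}. \<tau> i \<omega> < \<tau> (Suc i) \<omega>) \<and> \<tau> k \<omega> < \<infinity> \<and>
     order_isomorphic k p (\<lambda>i. \<omega> (the_enat (\<tau> i \<omega>)))"

text \<open>
  All times are finite here. \<open>T i\<close> is the time of the \<open>i\<close>-th choice, and \<open>J t\<close> is the number of choices
  up to time \<open>t\<close>.
\<close>

lemma placed_valid_run:
  assumes v: "valid_run \<tau> \<omega>"
  shows "\<exists>T J. (\<forall>i\<in>{1..k}. \<tau> i \<omega> = enat (T i)) \<and> (\<forall>i. 1 \<le> i \<longrightarrow> Suc i \<le> k \<longrightarrow> T i < T (Suc i)) \<and>
    (\<forall>t. J t \<le> k \<and> (\<forall>i\<in>{1..k}. T i \<le> t \<longleftrightarrow> i \<le> J t) \<and>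
         placed \<tau> t \<omega> = map (\<lambda>i. cell (\<omega> (T i))) [1..<Suc (J t)])"
proof -
  have less: "\<tau> i \<omega> < \<tau> j \<omega>" if "1 \<le> i" "i < j" "j \<le> k" for i j
    by (rule strict_chain_less[of k "\<lambda>i. \<tau> i \<omega>"]) (use v that in \<open>auto simp: valid_run_def\<close>)
  define T where "T i = the_enat (\<tau> i \<omega>)" for i
  have T: "\<tau> i \<omega> = enat (T i)" if "i \<in> {1..k}" for i
  proof -
    have "\<tau> i \<omega> < \<infinity>"
    proof (cases "i = k")
      case True then show ?thesis using v unfolding valid_run_def by simp
    next
      case False
      then have "\<tau> i \<omega> < \<tau> k \<omega>" using less that by auto
      then show ?thesis using v unfolding valid_run_def by (blast intro: order.strict_trans)
    qed
    then show ?thesis unfolding T_def by (cases "\<tau> i \<omega>") auto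
  qed
  have one: "1 \<le> \<tau> i \<omega>" if "i \<in> {1..k}" for i
    using less[of 1 i] v that unfolding valid_run_def
    by (cases "i = 1") (auto intro: order_trans less_imp_le)
  have Tless: "T i < T j" if "1 \<le> i" "i < j" "j \<le> k" for i j
    using less[OF that] T[of i] T[of j] that by simp
  have "\<exists>j\<le>k. (\<forall>i\<in>{1..k}. T i \<le> t \<longleftrightarrow> i \<le> j) \<and>
         placed \<tau> t \<omega> = map (\<lambda>i. cell (\<omega> (T i))) [1..<Suc j]" for t
  proof -
    let ?S = "insert 0 {i\<in>{1..k}. T i \<le> t}"
    define j where "j = Max ?S"
    have "j \<in> ?S" unfolding j_def by (rule Max_in) auto
    then have jk: "j \<le> k" and j: "j = 0 \<or> T j \<le> t" by auto
    have *: "T i \<le> t \<longleftrightarrow> i \<le> j" if i: "i \<in> {1..k}" for i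
    proof
      show "T i \<le> t \<Longrightarrow> i \<le> j" unfolding j_def using i by (intro Max_ge) auto
      show "i \<le> j \<Longrightarrow> T i \<le> t" using j Tless[of i j] i jk by (cases "i = j") auto
    qed
    define m where "m i = (if 1 \<le> \<tau> i \<omega> \<and> \<tau> i \<omega> \<le> enat t then cell (\<omega> (the_enat (\<tau> i \<omega>))) else 0)" for i
    have m: "m i = (if i \<le> j then cell (\<omega> (T i)) else 0)" if "i \<in> {1..k}" for i
      unfolding m_def using one[OF that] T[OF that] *[OF that] by simp
    have nz: "cell x \<noteq> 0" for x using cell_range[of x] by auto
    have "placed \<tau> t \<omega> = take j (map m [1..<Suc k])"
      unfolding placed_def m_def[symmetric]
    proof (rule takeWhile_eq_take_P_nth)
      fix i assume "i < j" "i < length (map m [1..<Suc k])"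
      then show "map m [1..<Suc k] ! i \<noteq> 0" using m[of "Suc i"] nz jk by (simp del: upt_Suc)
    next
      assume "j < length (map m [1..<Suc k])"
      then show "\<not> map m [1..<Suc k] ! j \<noteq> 0" using m[of "Suc j"] by (simp del: upt_Suc)
    qed
    also have "\<dots> = map m [1..<Suc j]"
      unfolding take_map using jk by (simp add: take_upt del: upt_Suc)
    also have "\<dots> = map (\<lambda>i. cell (\<omega> (T i))) [1..<Suc j]"
      using m jk by (intro map_cong) auto
    finally show ?thesis using jk * by blast
  qed
  then obtain J where "\<forall>t. J t \<le> k \<and> (\<forall>i\<in>{1..k}. T i \<le> t \<longleftrightarrow> i \<le> J t) \<and>
         placed \<tau> t \<omega> = map (\<lambda>i. cell (\<omega> (T i))) [1..<Suc (J t)]" by metis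
  then show ?thesis using T Tless by (intro exI[of _ T] exI[of _ J]) simp
qed

lemma consistent_placed:
  assumes v: "valid_run \<tau> \<omega>" shows "consistent (placed \<tau> t \<omega>)"
proof -
  obtain T J where T: "\<forall>i\<in>{1..k}. \<tau> i \<omega> = enat (T i)" and J: "J t \<le> k"
    "placed \<tau> t \<omega> = map (\<lambda>i. cell (\<omega> (T i))) [1..<Suc (J t)]"
    using placed_valid_run[OF v] by blast
  have less: "cell (\<omega> (T (Suc i))) \<le> cell (\<omega> (T (Suc i')))"
    if "i < J t" "i' < J t" "p (Suc i) < p (Suc i')" for i i'
  proof (rule cell_mono)
    have "Suc i \<in> {1..k}" "Suc i' \<in> {1..k}" using that J(1) by auto
    moreover from this have "\<omega> (the_enat (\<tau> (Suc i) \<omega>)) < \<omega> (the_enat (\<tau> (Suc i') \<omega>))"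
      using v that unfolding valid_run_def order_isomorphic_def by blast
    ultimately show "\<omega> (T (Suc i)) \<le> \<omega> (T (Suc i'))" using T by simp
  qed
  have "set (placed \<tau> t \<omega>) \<subseteq> {1..q}" using cell_range unfolding J(2) by auto
  then show ?thesis unfolding consistent_def J(2) using less by (simp del: upt_Suc)
qed

text \<open>
  The choice times are strictly increasing, so at most one element is placed per time step, and it can
  only be placed into the cell of the current sample.
\<close>

lemma placed_Suc:
  assumes v: "valid_run \<tau> \<omega>"
  shows "placed \<tau> (Suc t) \<omega> = placed \<tau> t \<omega> \<or>
    length (placed \<tau> t \<omega>) < k \<and> placed \<tau> (Suc t) \<omega> = placed \<tau> t \<omega> @ [cell (\<omega> (Suc t))]"
proof -
  obtain T J where T: "\<forall>i. 1 \<le> i \<longrightarrow> Suc i \<le> k \<longrightarrow> T i < T (Suc i)"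
    and J: "\<And>t. J t \<le> k" "\<And>t. \<forall>i\<in>{1..k}. T i \<le> t \<longleftrightarrow> i \<le> J t"
    "\<And>t. placed \<tau> t \<omega> = map (\<lambda>i. cell (\<omega> (T i))) [1..<Suc (J t)]"
    using placed_valid_run[OF v] by blast
  have J_iff: "T i \<le> s \<longleftrightarrow> i \<le> J s" if "1 \<le> i" "i \<le> k" for i s using J(2) that by auto
  have "J t \<le> J (Suc t)"
    using J(1)[of t] J_iff[of "J t" t] J_iff[of "J t" "Suc t"] by (cases "J t = 0") auto
  moreover have "J (Suc t) \<le> Suc (J t)"
  proof (rule ccontr)
    assume "\<not> ?thesis"
    then have a: "Suc (Suc (J t)) \<le> J (Suc t)" by simp
    then have ak: "Suc (Suc (J t)) \<le> k" using J(1)[of "Suc t"] by linarith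
    have "T (Suc (J t)) < T (Suc (Suc (J t)))" using T ak by simp
    moreover have "T (Suc (Suc (J t))) \<le> Suc t" using J_iff[of "Suc (Suc (J t))" "Suc t"] a ak by simp
    moreover have "t < T (Suc (J t))" using J_iff[of "Suc (J t)" t] ak by simp
    ultimately show False by simp
  qed
  ultimately consider "J (Suc t) = J t" | "J (Suc t) = Suc (J t)" by linarith
  then show ?thesis
  proof cases
    case 1 then show ?thesis unfolding J(3) by simp
  next
    case 2
    then have k: "Suc (J t) \<le> k" using J(1)[of "Suc t"] by simp
    have "T (Suc (J t)) = Suc t"
      using J_iff[of "Suc (J t)" t] J_iff[of "Suc (J t)" "Suc t"] 2 k by simp
    then show ?thesis unfolding J(3) 2 using k by simp
  qed
qed

lemma placed_unfinished:
  assumes v: "valid_run \<tau> \<omega>"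
  shows "length (placed \<tau> t \<omega>) < k \<longleftrightarrow> enat t < \<tau> k \<omega>" and "length (placed \<tau> t \<omega>) \<le> k"
proof -
  obtain T J where T: "\<forall>i\<in>{1..k}. \<tau> i \<omega> = enat (T i)"
    and J: "J t \<le> k" "\<forall>i\<in>{1..k}. T i \<le> t \<longleftrightarrow> i \<le> J t"
    "placed \<tau> t \<omega> = map (\<lambda>i. cell (\<omega> (T i))) [1..<Suc (J t)]"
    using placed_valid_run[OF v] by blast
  have len: "length (placed \<tau> t \<omega>) = J t" unfolding J(3) by simp
  have "k \<in> {1..k}" using k1 by simp
  then have "T k \<le> t \<longleftrightarrow> k \<le> J t" "\<tau> k \<omega> = enat (T k)" using J(2) T by blast+
  then show "length (placed \<tau> t \<omega>) < k \<longleftrightarrow> enat t < \<tau> k \<omega>" "length (placed \<tau> t \<omega>) \<le> k"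
    unfolding len using J(1) by auto
qed

end

lemma sum_indicator_less_le_enat:
  "(\<Sum>t<T. of_bool (enat t < n)) \<le> ennreal_of_enat n"
proof (cases n)
  case (enat m)
  have "(\<Sum>t<T. of_bool (t < m)) = (of_nat (card ({..<T} \<inter> {t. t < m})) :: ennreal)"
    by (simp add: of_bool_def sum.If_cases)
  also have "\<dots> \<le> of_nat (card {..<m})"
    by (intro of_nat_mono card_mono) auto
  finally show ?thesis using enat by simp
qed simp

context cell_game
begin

text \<open>
  In terms of \<open>W t = cost (placed \<tau> t)\<close>: given the past, every cell is hit with
  probability at most \<open>1 / q\<close>, and the gains of a position add up to \<open>N\<close>. Hence the expectation of \<open>W\<close>
  decreases by at most \<open>N / q\<close> times the probability that the run is unfinished. Telescoping up to time
  \<open>T\<close> leaves the expectation of \<open>W T\<close>, which is bounded by the largest cost on unfinished runs.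
\<close>

lemma expected_cost_drop:
  assumes st: "\<And>i. i \<in> {1..k} \<Longrightarrow> stopping_time past (\<tau> i)"
    and v: "AE \<omega> in uniform_seq_space. valid_run \<tau> \<omega>"
  shows "cost [] \<le> N * k * seq.prob {\<omega>\<in>space uniform_seq_space. enat T < \<tau> k \<omega>}
    + N / q * (\<Sum>t<T. seq.prob {\<omega>\<in>space uniform_seq_space. enat t < \<tau> k \<omega>})"
proof -
  let ?U = "uniform_seq_space"
  define S where "S = {xs. set xs \<subseteq> {1..q} \<and> length xs \<le> k \<and> consistent xs}"
  define S' where "S' = {xs\<in>S. length xs < k}"
  have finS: "finite S" unfolding S_def
    by (rule finite_subset[OF _ finite_lists_length_le[of "{1..q}" k]]) auto
  then have finS': "finite S'" unfolding S'_def by simp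
  define E where "E t xs = {\<omega>\<in>space ?U. placed \<tau> t \<omega> = xs}" for t xs
  define C where "C t c = uniform_seq (Suc t) -` {x. cell x = c} \<inter> space ?U" for t c
  define Q where "Q t = {\<omega>\<in>space ?U. enat t < \<tau> k \<omega>}" for t
  have E_past: "E t xs \<in> sets (past (enat t))" for t xs
    unfolding E_def by (rule placed_measurable[OF st])
  then have [measurable]: "E t xs \<in> sets ?U" for t xs using past_subset by blast
  have cellset: "{x. cell x = c} \<in> sets borel" for c
    using measurable_sets[OF measurable_cell, of "{c}"] by (simp add: vimage_def)
  have [measurable]: "C t c \<in> sets ?U" for t c
    unfolding C_def using measurable_sets[OF measurable_uniform_seq cellset] by simp
  have [measurable]: "Q t \<in> sets ?U" for t
  proof -
    have "{\<omega>\<in>space (past (enat t)). enat t < \<tau> k \<omega>} \<in> sets (past (enat t))"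
      using stopping_timeD2[OF st[of k], of "enat t"] k1 by (simp add: pred_def)
    then show ?thesis unfolding Q_def using past_subset by auto
  qed
  define W where "W t \<omega> = (\<Sum>xs\<in>S. cost xs * indicator (E t xs) \<omega>)" for t \<omega>
  \<comment> \<open>The gain of an algorithm that accepts whatever is admissible, hence an upper bound for the actual drop.\<close>
  define Y where "Y t \<omega> = (\<Sum>xs\<in>S'. \<Sum>c\<in>extensions xs. gain xs c * indicator (E t xs \<inter> C t c) \<omega>)" for t \<omega>
  have intW: "integrable ?U (W t)" for t
    unfolding W_def by (intro Bochner_Integration.integrable_sum integrable_mult_right)
      (auto simp: integrable_indicator_iff less_top[symmetric])
  have intY: "integrable ?U (Y t)" for t
    unfolding Y_def by (intro Bochner_Integration.integrable_sum integrable_mult_right)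
      (auto simp: integrable_indicator_iff less_top[symmetric])
  have W: "W t \<omega> = cost (placed \<tau> t \<omega>)" if "\<omega> \<in> space ?U" "placed \<tau> t \<omega> \<in> S" for t \<omega>
  proof -
    have "W t \<omega> = (\<Sum>xs\<in>S. if placed \<tau> t \<omega> = xs then cost xs else 0)"
      unfolding W_def using that by (intro sum.cong) (auto simp: E_def)
    then show ?thesis using that finS by simp
  qed
  have pS: "placed \<tau> t \<omega> \<in> S" if "valid_run \<tau> \<omega>" for t \<omega>
    unfolding S_def using consistent_placed[OF that] placed_unfinished(2)[OF that]
    by (auto simp: consistent_def)
  have Y_nonneg: "0 \<le> Y t \<omega>" for t \<omega>
    unfolding Y_def by (intro sum_nonneg mult_nonneg_nonneg gain_nonneg) auto
  have stepAE: "AE \<omega> in ?U. W t \<omega> \<le> W (Suc t) \<omega> + Y t \<omega>" for t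
    using v AE_space
  proof eventually_elim
    case (elim \<omega>)
    let ?xs = "placed \<tau> t \<omega>" and ?c = "cell (\<omega> (Suc t))"
    note W' = W[OF elim(2) pS[OF elim(1)]]
    from placed_Suc[OF elim(1), of t] show ?case
    proof (elim disjE conjE)
      assume "placed \<tau> (Suc t) \<omega> = ?xs"
      then show ?thesis using W'[of t] W'[of "Suc t"] Y_nonneg[of t \<omega>] by simp
    next
      assume len: "length ?xs < k" and eq: "placed \<tau> (Suc t) \<omega> = ?xs @ [?c]"
      have c: "?c \<in> extensions ?xs"
        using consistent_placed[OF elim(1), of "Suc t"] eq by (simp add: extensions_def)
      have xs: "?xs \<in> S'" using pS[OF elim(1)] len by (simp add: S'_def)
      have "\<omega> \<in> E t ?xs \<inter> C t ?c" using elim by (simp add: E_def C_def uniform_seq_def)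
      then have "gain ?xs ?c = gain ?xs ?c * indicator (E t ?xs \<inter> C t ?c) \<omega>" by simp
      also have "\<dots> \<le> (\<Sum>c\<in>extensions ?xs. gain ?xs c * indicator (E t ?xs \<inter> C t c) \<omega>)"
        using c by (intro member_le_sum[of ?c]) (auto intro: mult_nonneg_nonneg gain_nonneg)
      also have "\<dots> \<le> Y t \<omega>" unfolding Y_def
        using xs finS' by (intro member_le_sum[of ?xs]) (auto intro!: sum_nonneg mult_nonneg_nonneg gain_nonneg)
      finally have "gain ?xs ?c \<le> Y t \<omega>" .
      then show ?thesis using W'[of t] W'[of "Suc t"] eq unfolding gain_def by simp
    qed
  qed
  have expY: "(\<integral>\<omega>. Y t \<omega> \<partial>?U) \<le> N / q * seq.prob (Q t)" for t
  proof -
    have "(\<integral>\<omega>. Y t \<omega> \<partial>?U) = (\<Sum>xs\<in>S'. \<Sum>c\<in>extensions xs. gain xs c * seq.prob (E t xs \<inter> C t c))"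
    proof -
      have int: "integrable ?U (\<lambda>\<omega>. gain xs c * indicator (E t xs \<inter> C t c) \<omega>)" for xs c
        by (intro integrable_mult_right) (auto simp: integrable_indicator_iff less_top[symmetric])
      have "(\<integral>\<omega>. Y t \<omega> \<partial>?U)
          = (\<Sum>xs\<in>S'. \<integral>\<omega>. (\<Sum>c\<in>extensions xs. gain xs c * indicator (E t xs \<inter> C t c) \<omega>) \<partial>?U)"
        unfolding Y_def by (intro Bochner_Integration.integral_sum Bochner_Integration.integrable_sum int)
      also have "\<dots> = (\<Sum>xs\<in>S'. \<Sum>c\<in>extensions xs. \<integral>\<omega>. gain xs c * indicator (E t xs \<inter> C t c) \<omega> \<partial>?U)"
        by (intro sum.cong refl Bochner_Integration.integral_sum int)
      also have "\<dots> = (\<Sum>xs\<in>S'. \<Sum>c\<in>extensions xs. gain xs c * seq.prob (E t xs \<inter> C t c))"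
        by (intro sum.cong refl) simp
      finally show ?thesis .
    qed
    also have "\<dots> \<le> (\<Sum>xs\<in>S'. \<Sum>c\<in>extensions xs. gain xs c * (seq.prob (E t xs) * (1 / q)))"
    proof (intro sum_mono mult_left_mono gain_nonneg)
      fix xs c
      have "seq.prob (E t xs \<inter> C t c) = seq.prob (E t xs) * measure unif {x. cell x = c}"
        unfolding C_def by (rule past_indep[OF E_past cellset])
      also have "\<dots> \<le> seq.prob (E t xs) * (1 / q)"
        by (intro mult_left_mono measure_cell_le) auto
      finally show "seq.prob (E t xs \<inter> C t c) \<le> seq.prob (E t xs) * (1 / q)" .
    qed
    also have "\<dots> = (\<Sum>xs\<in>S'. N * (seq.prob (E t xs) * (1 / q)))"
    proof (rule sum.cong[OF refl])
      fix xs assume "xs \<in> S'"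
      then have "(\<Sum>c\<in>extensions xs. gain xs c) = N" unfolding S'_def S_def by (intro sum_gain) auto
      then show "(\<Sum>c\<in>extensions xs. gain xs c * (seq.prob (E t xs) * (1 / q))) = N * (seq.prob (E t xs) * (1 / q))"
        unfolding sum_distrib_right[symmetric] by (simp only:)
    qed
    also have "\<dots> = N / q * (\<Sum>xs\<in>S'. seq.prob (E t xs))"
      by (simp add: sum_distrib_left)
    also have "(\<Sum>xs\<in>S'. seq.prob (E t xs)) = seq.prob (\<Union>xs\<in>S'. E t xs)"
    proof (rule seq.finite_measure_finite_Union[symmetric])
      show "E t ` S' \<subseteq> seq.events" by auto
      show "disjoint_family_on (E t) S'" by (auto simp: disjoint_family_on_def E_def)
    qed (rule finS')
    also have "seq.prob (\<Union>xs\<in>S'. E t xs) \<le> seq.prob (Q t)"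
    proof (rule seq.finite_measure_mono_AE)
      show "AE \<omega> in ?U. \<omega> \<in> (\<Union>xs\<in>S'. E t xs) \<longrightarrow> \<omega> \<in> Q t"
        using v
      proof eventually_elim
        case (elim \<omega>)
        then show ?case using placed_unfinished(1)[OF elim, of t] by (auto simp: E_def S'_def Q_def)
      qed
    qed simp
    finally show ?thesis using N_pos q1 by (simp add: mult_left_mono divide_right_mono)
  qed
  have main: "cost [] \<le> (\<integral>\<omega>. W T \<omega> \<partial>?U) + N / q * (\<Sum>t<T. seq.prob (Q t))" for T
  proof (induction T)
    case 0
    have "[] \<in> S" by (simp add: S_def)
    then have "(\<integral>\<omega>. W 0 \<omega> \<partial>?U) = (\<integral>\<omega>. cost [] \<partial>?U)"
      using W[of _ 0] by (intro Bochner_Integration.integral_cong) (auto simp: placed_0)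
    then show ?case by (simp add: seq.prob_space)
  next
    case (Suc T)
    have "(\<integral>\<omega>. W T \<omega> \<partial>?U) \<le> (\<integral>\<omega>. W (Suc T) \<omega> + Y T \<omega> \<partial>?U)"
      by (rule integral_mono_AE) (use intW intY stepAE in auto)
    also have "\<dots> = (\<integral>\<omega>. W (Suc T) \<omega> \<partial>?U) + (\<integral>\<omega>. Y T \<omega> \<partial>?U)"
      using intW intY by simp
    finally have "(\<integral>\<omega>. W T \<omega> \<partial>?U) \<le> (\<integral>\<omega>. W (Suc T) \<omega> \<partial>?U) + N / q * seq.prob (Q T)"
      using expY[of T] by linarith
    then show ?case using Suc by (simp add: distrib_left)
  qed
  have "(\<integral>\<omega>. W T \<omega> \<partial>?U) \<le> (\<integral>\<omega>. N * k * indicator (Q T) \<omega> \<partial>?U)"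
  proof (rule integral_mono_AE)
    show "AE \<omega> in ?U. W T \<omega> \<le> N * k * indicator (Q T) \<omega>"
      using v AE_space
    proof eventually_elim
      case (elim \<omega>)
      let ?xs = "placed \<tau> T \<omega>"
      have Wc: "W T \<omega> = cost ?xs" by (rule W[OF elim(2) pS[OF elim(1)]])
      show ?case
      proof (cases "length ?xs < k")
        case True
        then have "\<omega> \<in> Q T" using placed_unfinished(1)[OF elim(1), of T] elim(2) by (simp add: Q_def)
        moreover have "cost ?xs \<le> N * k"
          using cost_bounds[OF consistent_placed[OF elim(1), of T]] N_pos
          by (meson diff_le_self less_imp_le mult_left_mono of_nat_mono order_trans)
        ultimately show ?thesis using Wc by simp
      next
        case False
        then show ?thesis using Wc N_pos by (simp add: indicator_def)
      qed
    qed
  qed (auto simp: intW integrable_indicator_iff less_top[symmetric] intro!: integrable_mult_right)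
  then show ?thesis using main[of T] unfolding Q_def[symmetric] by simp
qed

text \<open>
  Summing the probabilities of unfinished runs gives the expected time. If this is
  finite, the remainder term of \<open>expected_cost_drop\<close> vanishes as \<open>T\<close> grows.
\<close>

lemma cost_le_online_time:
  assumes \<tau>: "\<tau> \<in> OA uniform_seq_space uniform_seq k p"
  shows "ennreal (cost []) \<le> ennreal (N / q) * (\<integral>\<^sup>+\<omega>. ennreal_of_enat (\<tau> k \<omega>) \<partial>uniform_seq_space)"
proof -
  let ?U = "uniform_seq_space"
  let ?I = "\<integral>\<^sup>+\<omega>. ennreal_of_enat (\<tau> k \<omega>) \<partial>?U"
  define P where "P t = seq.prob {\<omega>\<in>space ?U. enat t < \<tau> k \<omega>}" for t
  have st: "\<And>i. i \<in> {1..k} \<Longrightarrow> stopping_time past (\<tau> i)"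
    using \<tau> unfolding OA_def by blast
  have v: "AE \<omega> in ?U. valid_run \<tau> \<omega>"
    using \<tau> unfolding OA_def valid_run_def uniform_seq_def by blast
  have Q: "{\<omega>\<in>space ?U. enat t < \<tau> k \<omega>} \<in> sets ?U" for t
  proof -
    have "{\<omega>\<in>space (past (enat t)). enat t < \<tau> k \<omega>} \<in> sets (past (enat t))"
      using stopping_timeD2[OF st[of k], of "enat t"] k1 by (simp add: pred_def)
    then show ?thesis using past_subset by auto
  qed
  have sumP: "ennreal (\<Sum>t<T. P t) \<le> ?I" for T
  proof -
    have "ennreal (\<Sum>t<T. P t) = (\<Sum>t<T. \<integral>\<^sup>+\<omega>. indicator {\<omega>\<in>space ?U. enat t < \<tau> k \<omega>} \<omega> \<partial>?U)"
      using Q by (simp add: P_def seq.emeasure_eq_measure)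
    also have "\<dots> = (\<integral>\<^sup>+\<omega>. (\<Sum>t<T. indicator {\<omega>\<in>space ?U. enat t < \<tau> k \<omega>} \<omega>) \<partial>?U)"
      using Q by (subst nn_integral_sum) auto
    also have "\<dots> = (\<integral>\<^sup>+\<omega>. (\<Sum>t<T. of_bool (enat t < \<tau> k \<omega>)) \<partial>?U)"
      by (intro nn_integral_cong sum.cong) (auto simp: indicator_def)
    also have "\<dots> \<le> ?I" by (intro nn_integral_mono sum_indicator_less_le_enat)
    finally show ?thesis .
  qed
  show ?thesis
  proof (cases "?I = \<infinity>")
    case True
    then show ?thesis using N_pos q1 by (simp add: ennreal_mult_top)
  next
    case False
    then obtain e where e: "e \<ge> 0" "?I = ennreal e" by (cases ?I) auto
    have s: "(\<Sum>t<T. P t) \<le> e" for T using sumP[of T] e by (simp add: ennreal_le_iff)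
    have mono: "P T \<le> P t" if "t \<le> T" for t T
    proof -
      have "enat t < \<tau> k \<omega>" if "enat T < \<tau> k \<omega>" for \<omega>
        using that \<open>t \<le> T\<close> by (meson enat_ord_simps(1) le_less_trans)
      then show ?thesis unfolding P_def using Q by (intro seq.finite_measure_mono) auto
    qed
    have bound: "cost [] \<le> N * k * (e / T) + N / q * e" if "T > 0" for T :: nat
    proof -
      have "real T * P T = (\<Sum>t<T. P T)" by simp
      also have "\<dots> \<le> (\<Sum>t<T. P t)" by (intro sum_mono mono) auto
      also have "\<dots> \<le> e" by (rule s)
      finally have "P T \<le> e / T" using that by (simp add: field_simps)
      then have "N * k * P T \<le> N * k * (e / T)" by (intro mult_left_mono) auto
      moreover have "N / q * (\<Sum>t<T. P t) \<le> N / q * e" using s by (intro mult_left_mono) auto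
      ultimately show ?thesis using expected_cost_drop[OF st v, of T] unfolding P_def by linarith
    qed
    have "(\<lambda>T. N * k * (e / real T) + N / q * e) \<longlonglongrightarrow> N * k * 0 + N / q * e"
      by (intro tendsto_intros lim_const_over_n)
    moreover have "\<forall>\<^sub>F T in sequentially. cost [] \<le> N * k * (e / real T) + N / q * e"
      using eventually_gt_at_top[of 0] by eventually_elim (rule bound)
    ultimately have "cost [] \<le> N / q * e"
      using tendsto_lowerbound[of _ _ sequentially] by fastforce
    then show ?thesis using e N_pos by (simp add: ennreal_mult[symmetric] ennreal_leI)
  qed
qed

end

section \<open>Playing the cell game on a random permutation\<close>

definition sorting :: "nat \<Rightarrow> (nat \<Rightarrow> real) \<Rightarrow> nat \<Rightarrow> nat" where
  "sorting n U = (SOME \<rho>. \<rho> permutes {1..n} \<and>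
     (\<forall>i\<in>{1..n}. \<forall>j\<in>{1..n}. i \<le> j \<longrightarrow> U (\<rho> i) \<le> U (\<rho> j)))"

lemma sorting:
  "sorting n U permutes {1..n} \<and>
     (\<forall>i\<in>{1..n}. \<forall>j\<in>{1..n}. i \<le> j \<longrightarrow> U (sorting n U i) \<le> U (sorting n U j))"
proof -
  define L where "L = sort_key U [1..<Suc n]"
  have L: "length L = n" "set L = {1..n}" "distinct L" "sorted (map U L)"
    unfolding L_def by (auto simp del: upt_Suc)
  define \<rho> where "\<rho> i = (if i \<in> {1..n} then L ! (i - 1) else i)" for i
  have "bij_betw (\<lambda>i. L ! i) {..<n} {1..n}" using bij_betw_nth[OF L(3)] L by auto
  moreover have "bij_betw (\<lambda>i. i - 1) {1..n} {..<n}"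
    by (rule bij_betw_byWitness[where f' = Suc]) auto
  ultimately have "bij_betw ((\<lambda>i. L ! i) \<circ> (\<lambda>i. i - 1)) {1..n} {1..n}"
    by (rule bij_betw_trans[rotated])
  moreover have "bij_betw \<rho> {1..n} {1..n} = bij_betw ((\<lambda>i. L ! i) \<circ> (\<lambda>i. i - 1)) {1..n} {1..n}"
    by (rule bij_betw_cong) (simp add: \<rho>_def)
  ultimately have "bij_betw \<rho> {1..n} {1..n}" by simp
  then have "\<rho> permutes {1..n}" by (rule bij_imp_permutes) (auto simp: \<rho>_def)
  moreover have "U (\<rho> i) \<le> U (\<rho> j)" if "i \<in> {1..n}" "j \<in> {1..n}" "i \<le> j" for i j
    using sorted_nth_mono[OF L(4), of "i - 1" "j - 1"] that L(1) by (simp add: \<rho>_def)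
  ultimately have "\<exists>\<rho>. \<rho> permutes {1..n} \<and>
     (\<forall>i\<in>{1..n}. \<forall>j\<in>{1..n}. i \<le> j \<longrightarrow> U (\<rho> i) \<le> U (\<rho> j))" by blast
  from someI_ex[OF this] show ?thesis unfolding sorting_def .
qed

text \<open>
  Exchangeability: if the arguments of a uniform \<open>U\<close> are rearranged by a permutation \<open>\<rho>\<close> that may
  depend on \<open>U\<close> and then by an independent uniform permutation, the result is again uniform. For fixed
  \<open>U\<close> the composition with \<open>\<rho>\<close> permutes the permutations; for a fixed permutation the composition
  permutes the functions \<open>U\<close>.
\<close>

lemma card_exchangeable:
  fixes A :: "'a set" and \<rho> :: "(nat \<Rightarrow> 'a) \<Rightarrow> nat \<Rightarrow> nat"
  assumes A: "finite A" and \<rho>: "\<And>U. \<rho> U permutes {1..n}"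
    and P: "\<And>f g. (\<And>t. t \<in> {1..n} \<Longrightarrow> f t = g t) \<Longrightarrow> P f = P g"
  shows "card {\<omega> \<in> ({1..n} \<rightarrow>\<^sub>E A) \<times> {\<pi>. \<pi> permutes {1..n}}. P (\<lambda>t. fst \<omega> (\<rho> (fst \<omega>) (snd \<omega> t)))}
    = card {\<pi>. \<pi> permutes {1..n}} * card {U \<in> {1..n} \<rightarrow>\<^sub>E A. P U}"
proof -
  let ?S = "{1..n} \<rightarrow>\<^sub>E A" and ?P = "{\<pi>. \<pi> permutes {1..n}}"
  have fin: "finite ?S" "finite ?P" using A by (auto intro: finite_PiE finite_permutations)
  have "{\<omega> \<in> ?S \<times> ?P. P (\<lambda>t. fst \<omega> (\<rho> (fst \<omega>) (snd \<omega> t)))}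
      = (SIGMA U:?S. {\<pi>\<in>?P. P (\<lambda>t. U (\<rho> U (\<pi> t)))})" by auto
  then have "card {\<omega> \<in> ?S \<times> ?P. P (\<lambda>t. fst \<omega> (\<rho> (fst \<omega>) (snd \<omega> t)))}
      = (\<Sum>U\<in>?S. card {\<pi>\<in>?P. P (\<lambda>t. U (\<rho> U (\<pi> t)))})"
    using fin by simp
  also have "\<dots> = (\<Sum>U\<in>?S. card {\<pi>\<in>?P. P (\<lambda>t. U (\<pi> t))})"
  proof (rule sum.cong[OF refl])
    fix U
    have inv: "\<rho> U (inv (\<rho> U) x) = x" "inv (\<rho> U) (\<rho> U x) = x" for x
      using permutes_inverses[OF \<rho>] by auto
    have "bij_betw (\<lambda>\<pi>. \<rho> U \<circ> \<pi>) {\<pi>\<in>?P. P (\<lambda>t. U (\<rho> U (\<pi> t)))} {\<pi>\<in>?P. P (\<lambda>t. U (\<pi> t))}"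
      by (rule bij_betw_byWitness[where f' = "\<lambda>\<pi>. inv (\<rho> U) \<circ> \<pi>"])
        (auto simp: fun_eq_iff inv simp del: One_nat_def intro: permutes_compose[OF _ \<rho>] permutes_compose[OF _ permutes_inv[OF \<rho>]])
    then show "card {\<pi>\<in>?P. P (\<lambda>t. U (\<rho> U (\<pi> t)))} = card {\<pi>\<in>?P. P (\<lambda>t. U (\<pi> t))}"
      by (rule bij_betw_same_card)
  qed
  also have "\<dots> = card (SIGMA U:?S. {\<pi>\<in>?P. P (\<lambda>t. U (\<pi> t))})"
    using fin by simp
  also have "\<dots> = card (SIGMA \<pi>:?P. {U\<in>?S. P (\<lambda>t. U (\<pi> t))})"
    by (rule bij_betw_same_card[of prod.swap]) (rule bij_betw_byWitness[where f' = prod.swap], auto)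
  also have "\<dots> = (\<Sum>\<pi>\<in>?P. card {U\<in>?S. P (\<lambda>t. U (\<pi> t))})"
    using fin by simp
  also have "\<dots> = (\<Sum>\<pi>\<in>?P. card {U\<in>?S. P U})"
  proof (rule sum.cong[OF refl])
    fix \<pi> assume "\<pi> \<in> ?P"
    then have \<pi>: "\<pi> permutes {1..n}" by simp
    have im: "\<pi> t \<in> {1..n}" "inv \<pi> t \<in> {1..n}" if "t \<in> {1..n}" for t
      using permutes_in_image[OF \<pi>] permutes_in_image[OF permutes_inv[OF \<pi>]] that by blast+
    have inv: "\<pi> (inv \<pi> x) = x" "inv \<pi> (\<pi> x) = x" for x
      using permutes_inverses[OF \<pi>] by auto
    let ?f = "\<lambda>\<pi> U. restrict (\<lambda>t. U (\<pi> t)) {1..n}"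
    have f: "?f \<pi>' U \<in> ?S" if "U \<in> ?S" "\<And>t. t \<in> {1..n} \<Longrightarrow> \<pi>' t \<in> {1..n}" for \<pi>' U
      unfolding restrict_PiE_iff using that by blast
    have Pf: "P (?f \<pi> U) = P (\<lambda>t. U (\<pi> t))" for U by (rule P) (rule restrict_apply')
    have back1: "?f (inv \<pi>) (?f \<pi> U) = U" if "U \<in> ?S" for U
    proof
      fix t show "?f (inv \<pi>) (?f \<pi> U) t = U t"
      proof (cases "t \<in> {1..n}")
        case True
        then show ?thesis by (simp only: restrict_apply im if_True inv)
      next
        case False
        then show ?thesis using PiE_arb[OF that False] by (simp only: restrict_apply if_False)
      qed
    qed
    have back2: "?f \<pi> (?f (inv \<pi>) U) = U" if "U \<in> ?S" for U
    proof
      fix t show "?f \<pi> (?f (inv \<pi>) U) t = U t"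
      proof (cases "t \<in> {1..n}")
        case True
        then show ?thesis by (simp only: restrict_apply im if_True inv)
      next
        case False
        then show ?thesis using PiE_arb[OF that False] by (simp only: restrict_apply if_False)
      qed
    qed
    have "bij_betw (?f \<pi>) {U\<in>?S. P (\<lambda>t. U (\<pi> t))} {U\<in>?S. P U}"
    proof (rule bij_betw_byWitness[where f' = "?f (inv \<pi>)"])
      show "\<forall>U\<in>{U\<in>?S. P (\<lambda>t. U (\<pi> t))}. ?f (inv \<pi>) (?f \<pi> U) = U" using back1 by blast
      show "\<forall>U\<in>{U\<in>?S. P U}. ?f \<pi> (?f (inv \<pi>) U) = U" using back2 by blast
      show "?f \<pi> ` {U\<in>?S. P (\<lambda>t. U (\<pi> t))} \<subseteq> {U\<in>?S. P U}" using f im Pf by blast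
      show "?f (inv \<pi>) ` {U\<in>?S. P U} \<subseteq> {U\<in>?S. P (\<lambda>t. U (\<pi> t))}"
      proof clarify
        fix U assume U: "U \<in> ?S" "P U"
        have V: "?f (inv \<pi>) U \<in> ?S" using f[OF U(1), of "inv \<pi>"] im by blast
        have "P (\<lambda>t. ?f (inv \<pi>) U (\<pi> t))" using U Pf[of "?f (inv \<pi>) U"] back2[OF U(1)] by simp
        then show "?f (inv \<pi>) U \<in> ?S \<and> P (\<lambda>t. ?f (inv \<pi>) U (\<pi> t))" using V by blast
      qed
    qed
    then show "card {U\<in>?S. P (\<lambda>t. U (\<pi> t))} = card {U\<in>?S. P U}" by (rule bij_betw_same_card)
  qed
  finally show ?thesis by simp
qed

lemma random_host_product:
  fixes S :: "(nat \<Rightarrow> real) set"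
  assumes S: "finite S" "S \<noteq> {}"
  shows "random_host (uniform_count_measure (S \<times> {p. p permutes {1..n}})) fst snd n"
proof -
  let ?P = "{p. p permutes {1..n}}"
  let ?\<Omega> = "S \<times> ?P"
  let ?M = "uniform_count_measure ?\<Omega>"
  have finP: "finite ?P" by (simp add: finite_permutations)
  have "id \<in> ?P" by (simp add: permutes_id)
  then have P: "?P \<noteq> {}" by blast
  have \<Omega>: "finite ?\<Omega>" "?\<Omega> \<noteq> {}" using S P finP by auto
  interpret prob_space ?M by (rule prob_space_uniform_count_measure[OF \<Omega>])
  have sp: "space ?M = ?\<Omega>" "sets ?M = Pow ?\<Omega>"
    by (simp_all add: space_uniform_count_measure sets_uniform_count_measure)
  have m: "prob X = card X / (card S * card ?P)" if "X \<subseteq> ?\<Omega>" for X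
    unfolding measure_uniform_count_measure[OF \<Omega>(1) that] by (simp add: card_cartesian_product)
  have X0: "fst \<in> measurable ?M (\<Pi>\<^sub>M i\<in>UNIV. borel)"
    unfolding measurable_def sp space_PiM by auto
  have \<sigma>: "snd \<in> measurable ?M (count_space ?P)"
    unfolding measurable_def sp by auto
  have pos: "card S \<noteq> 0" "card ?P \<noteq> 0" using S finP P by auto
  have "indep_set (sets (vimage_algebra (space ?M) fst (\<Pi>\<^sub>M i\<in>UNIV. borel)))
       (sets (vimage_algebra (space ?M) snd (count_space ?P)))"
  proof (rule indep_setI)
    have f: "fst \<in> space ?M \<rightarrow> space (\<Pi>\<^sub>M i\<in>UNIV. borel :: real measure)" by (simp add: space_PiM)
    have g: "snd \<in> space ?M \<rightarrow> space (count_space ?P)" unfolding sp by auto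
    note fg = sets_vimage_algebra2[OF f] sets_vimage_algebra2[OF g]
    show "sets (vimage_algebra (space ?M) fst (\<Pi>\<^sub>M i\<in>UNIV. borel)) \<subseteq> events"
      "sets (vimage_algebra (space ?M) snd (count_space ?P)) \<subseteq> events"
      unfolding fg unfolding sp by auto
    fix a b assume "a \<in> sets (vimage_algebra (space ?M) fst (\<Pi>\<^sub>M i\<in>UNIV. borel))"
      "b \<in> sets (vimage_algebra (space ?M) snd (count_space ?P))"
    then obtain A B where "a = fst -` A \<inter> ?\<Omega>" "b = snd -` B \<inter> ?\<Omega>" "B \<subseteq> ?P"
      unfolding fg unfolding sp by auto
    then have a: "a = (A \<inter> S) \<times> ?P" and b: "b = S \<times> B" and ab: "a \<inter> b = (A \<inter> S) \<times> B" and B: "B \<subseteq> ?P"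
      by auto
    have "prob a = card (A \<inter> S) * card ?P / (card S * card ?P)"
      unfolding a by (subst m) (auto simp: card_cartesian_product)
    moreover have "prob b = card S * card B / (card S * card ?P)"
      unfolding b using B by (subst m) (auto simp: card_cartesian_product)
    moreover have "prob (a \<inter> b) = card (A \<inter> S) * card B / (card S * card ?P)"
      unfolding ab using B by (subst m) (auto simp: card_cartesian_product)
    ultimately show "prob (a \<inter> b) = prob a * prob b" using pos by simp
  qed
  moreover have "distr ?M (count_space ?P) snd = uniform_count_measure ?P"
  proof (rule measure_eqI)
    show "sets (distr ?M (count_space ?P) snd) = sets (uniform_count_measure ?P)"
      by (simp add: sets_uniform_count_measure)
    fix A assume "A \<in> sets (distr ?M (count_space ?P) snd)"
    then have A: "A \<subseteq> ?P" by simp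
    have "snd -` A \<inter> space ?M = S \<times> A" using A unfolding sp by auto
    then have "emeasure (distr ?M (count_space ?P) snd) A = emeasure ?M (S \<times> A)"
      using A by (subst emeasure_distr[OF \<sigma>]) simp_all
    also have "\<dots> = ennreal (card S * card A / (card S * card ?P))"
      unfolding emeasure_eq_measure using A by (subst m) (auto simp: card_cartesian_product)
    also have "\<dots> = emeasure (uniform_count_measure ?P) A"
      using pos A by (subst emeasure_uniform_count_measure[OF finP]) auto
    finally show "emeasure (distr ?M (count_space ?P) snd) A = emeasure (uniform_count_measure ?P) A" .
  qed
  ultimately show ?thesis unfolding random_host_def using prob_space_axioms X0 \<sigma> by blast
qed

text \<open>
  On a finite sample space every event that depends only on \<open>X0\<close> and the first \<open>t\<close> values of \<open>\<sigma>\<close>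
  belongs to the filtration, as a finite union of atoms.
\<close>

lemma host_filtration_sets:
  fixes S :: "(nat \<Rightarrow> real) set" and n :: nat
  defines "\<Omega> \<equiv> S \<times> {p. p permutes {1..n}}"
  assumes S: "finite S" and t: "t \<le> n" and B: "B \<subseteq> \<Omega>"
    and dep: "\<And>\<omega> \<omega>'. \<omega> \<in> B \<Longrightarrow> \<omega>' \<in> \<Omega> \<Longrightarrow> fst \<omega>' = fst \<omega> \<Longrightarrow>
        (\<And>s. s \<in> {1..t} \<Longrightarrow> snd \<omega>' s = snd \<omega> s) \<Longrightarrow> \<omega>' \<in> B"
  shows "B \<in> sets (host_filtration (uniform_count_measure \<Omega>) fst snd n t)"
proof -
  let ?F = "host_filtration (uniform_count_measure \<Omega>) fst snd n t"
  let ?G = "{fst -` A \<inter> \<Omega> | A. A \<in> sets (\<Pi>\<^sub>M i\<in>UNIV. borel :: real measure)} \<union>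
      (\<Union>s\<in>{s. 1 \<le> s \<and> s \<le> t \<and> s \<le> n}. range (\<lambda>j. {\<omega>\<in>\<Omega>. snd \<omega> s = j}))"
  have G: "?G \<subseteq> Pow \<Omega>" by auto
  have F: "space ?F = \<Omega>" "sets ?F = sigma_sets \<Omega> ?G"
    unfolding host_filtration_def space_uniform_count_measure
    using G by (auto intro!: space_measure_of sets_measure_of)
  define atom where "atom \<omega> = {\<omega>'\<in>\<Omega>. fst \<omega>' = fst \<omega>} \<inter> {\<omega>'\<in>\<Omega>. \<forall>s\<in>{1..t}. snd \<omega>' s = snd \<omega> s}" for \<omega>
  have "atom \<omega> \<in> sets ?F" for \<omega>
  proof -
    have "(\<Pi>\<^sub>E i\<in>UNIV. {fst \<omega> i}) \<in> sets (\<Pi>\<^sub>M i\<in>UNIV. borel :: real measure)"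
      by (rule sets_PiM_I_countable) auto
    then have "{fst \<omega>} \<in> sets (\<Pi>\<^sub>M i\<in>UNIV. borel :: real measure)"
      by (simp add: PiE_singleton)
    moreover have "{\<omega>'\<in>\<Omega>. fst \<omega>' = fst \<omega>} = fst -` {fst \<omega>} \<inter> \<Omega>" by auto
    ultimately have 1: "{\<omega>'\<in>\<Omega>. fst \<omega>' = fst \<omega>} \<in> sets ?F"
      unfolding F(2) by (intro sigma_sets.Basic) blast
    have "{\<omega>'\<in>space ?F. \<forall>s\<in>{1..t}. snd \<omega>' s = snd \<omega> s} \<in> sets ?F"
    proof (rule sets.sets_Collect_finite_All)
      fix s assume "s \<in> {1..t}"
      then show "{\<omega>'\<in>space ?F. snd \<omega>' s = snd \<omega> s} \<in> sets ?F"
        using t unfolding F by (intro sigma_sets.Basic) auto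
    qed simp
    then show ?thesis using 1 unfolding atom_def F(1) by (rule sets.Int[rotated])
  qed
  moreover have "B = (\<Union>\<omega>\<in>B. atom \<omega>)"
    using B dep unfolding atom_def by blast
  moreover have "finite B" using B S unfolding \<Omega>_def
    by (intro finite_subset[OF B[unfolded \<Omega>_def]]) (auto simp: finite_permutations)
  ultimately show ?thesis by (metis sets.finite_UN)
qed

context cell_game
begin

lemma card_failing_streams:
  "card {us. length us = n \<and> set us \<subseteq> {1..q+k} \<and> length (foldl step xs us) < k} = fail n xs * N ^ n"
proof (induction n arbitrary: xs)
  case 0
  have "{us. length us = 0 \<and> set us \<subseteq> {1..q+k} \<and> length (foldl step xs us) < k}
     = (if length xs < k then {[]} else {})" by auto
  then show ?case by simp
next
  case (Suc n)
  let ?B = "\<lambda>xs. {us. length us = n \<and> set us \<subseteq> {1..q+k} \<and> length (foldl step xs us) < k}"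
  have finB: "finite (?B xs)" for xs
    by (rule finite_subset[OF _ finite_lists_length_eq[of "{1..q+k}" n]]) auto
  have "{us. length us = Suc n \<and> set us \<subseteq> {1..q+k} \<and> length (foldl step xs us) < k}
      = (\<lambda>(u, us). u # us) ` (SIGMA u:{1..q+k}. ?B (step xs u))"
    by (auto simp: length_Suc_conv image_iff)
  then have "card {us. length us = Suc n \<and> set us \<subseteq> {1..q+k} \<and> length (foldl step xs us) < k}
      = card (SIGMA u:{1..q+k}. ?B (step xs u))"
    by (simp only:) (rule card_image, auto simp: inj_on_def)
  also have "\<dots> = (\<Sum>u\<in>{1..q+k}. card (?B (step xs u)))" using finB by (intro card_SigmaI) auto
  finally have "real (card {us. length us = Suc n \<and> set us \<subseteq> {1..q+k} \<and> length (foldl step xs us) < k})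
     = (\<Sum>u\<in>{1..q+k}. fail n (step xs u) * N ^ n)" by (simp only: of_nat_sum Suc)
  also have "\<dots> = fail (Suc n) xs * N ^ Suc n"
    unfolding sum_distrib_right[symmetric] using N_pos by simp
  finally show ?case .
qed

text \<open>
  The position after the first \<open>t\<close> letters of the stream \<open>u\<close>, whose indices start at \<open>1\<close>.
\<close>

definition state :: "(nat \<Rightarrow> nat) \<Rightarrow> nat \<Rightarrow> nat list" where
  "state u t = foldl step [] (map u [1..<Suc t])"

lemma state_0 [simp]: "state u 0 = []" by (simp add: state_def)

lemma state_Suc: "state u (Suc t) = step (state u t) (u (Suc t))" by (simp add: state_def)

lemma state_cong: "(\<And>s. s \<in> {1..t} \<Longrightarrow> u s = v s) \<Longrightarrow> state u t = state v t"
  unfolding state_def by (intro arg_cong[of _ _ "foldl step []"] map_cong) auto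

lemma consistent_state: "consistent (state u t)"
  by (induction t) (auto simp: state_Suc intro: consistent_step)

lemma state_prefix: "s \<le> t \<Longrightarrow> \<exists>ys. state u t = state u s @ ys"
proof (induction t rule: dec_induct)
  case (step t)
  then show ?case by (auto simp: state_Suc step_def)
qed simp

lemma length_state_mono: "s \<le> t \<Longrightarrow> length (state u s) \<le> length (state u t)"
  using state_prefix[of s t u] by auto

text \<open>
  The time at which the \<open>i\<close>-th element is placed, or \<open>n + 1\<close> if this does not happen up to time \<open>n\<close>.
  Counting the times before it makes monotonicity in \<open>i\<close> and the bound \<open>n + 1\<close> immediate.
\<close>

definition arrival :: "nat \<Rightarrow> (nat \<Rightarrow> nat) \<Rightarrow> nat \<Rightarrow> nat" where
  "arrival n u i = Suc (card {t\<in>{1..n}. length (state u t) < i})"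

lemma arrival_le_iff:
  assumes "t \<le> n" "1 \<le> i"
  shows "arrival n u i \<le> t \<longleftrightarrow> i \<le> length (state u t)"
proof
  assume i: "i \<le> length (state u t)"
  then have t: "t > 0" using assms by (cases t) auto
  have "{s\<in>{1..n}. length (state u s) < i} \<subseteq> {1..<t}"
  proof
    fix s assume s: "s \<in> {s\<in>{1..n}. length (state u s) < i}"
    then have "\<not> t \<le> s" using i length_state_mono[of t s u] by auto
    then show "s \<in> {1..<t}" using s by auto
  qed
  then have "card {s\<in>{1..n}. length (state u s) < i} \<le> card {1..<t}" by (intro card_mono) auto
  then show "arrival n u i \<le> t" using t by (simp add: arrival_def)
next
  assume a: "arrival n u i \<le> t"
  show "i \<le> length (state u t)"
  proof (rule ccontr)
    assume "\<not> ?thesis"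
    then have "{1..t} \<subseteq> {s\<in>{1..n}. length (state u s) < i}"
    proof (intro subsetI CollectI conjI)
      fix s assume "s \<in> {1..t}"
      then show "s \<in> {1..n}" "length (state u s) < i"
        using length_state_mono[of s t u] assms(1) \<open>\<not> i \<le> length (state u t)\<close> by auto
    qed
    then have "card {1..t} \<le> card {s\<in>{1..n}. length (state u s) < i}" by (intro card_mono) auto
    then show False using a by (simp add: arrival_def)
  qed
qed

lemma arrival_mono: "i \<le> j \<Longrightarrow> arrival n u i \<le> arrival n u j"
  unfolding arrival_def by (intro Suc_le_mono[THEN iffD2] card_mono) auto

lemma arrival_le: "arrival n u i \<le> Suc n"
proof -
  have "card {t\<in>{1..n}. length (state u t) < i} \<le> card {1..n}" by (intro card_mono) auto
  then show ?thesis by (simp add: arrival_def)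
qed

lemma arrival_value:
  assumes "i \<in> {1..k}" "arrival n u i \<le> n"
  shows "i \<le> length (state u n) \<and> u (arrival n u i) = state u n ! (i - 1) + p i"
proof -
  obtain t where t: "arrival n u i = Suc t" by (simp add: arrival_def)
  have tn: "Suc t \<le> n" using assms t by simp
  have "i \<le> length (state u (Suc t))" using arrival_le_iff[OF tn, of i u] assms t by simp
  moreover have "\<not> i \<le> length (state u t)" using arrival_le_iff[of t n i u] assms t tn by simp
  ultimately have acc: "accepts (state u t) (u (Suc t))" and len: "i = Suc (length (state u t))"
    by (auto simp: state_Suc step_def split: if_splits)
  then have st: "state u (Suc t) = state u t @ [u (Suc t) - p i]" and "p i < u (Suc t)"
    by (auto simp: state_Suc step_def accepts_def)
  moreover obtain ys where "state u n = state u (Suc t) @ ys" using state_prefix[OF tn] by blast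
  ultimately show ?thesis using len t by (simp add: nth_append)
qed

text \<open>
  Here the shift pays off: cells are only weakly ordered, but the letters exceed them by the
  ranks \<open>p i\<close> and are therefore strictly ordered.
\<close>

lemma arrival_order:
  assumes "arrival n u k \<le> n" "i \<in> {1..k}" "j \<in> {1..k}" "p i < p j"
  shows "u (arrival n u i) < u (arrival n u j)"
proof -
  have le: "arrival n u i \<le> n" "arrival n u j \<le> n"
    using arrival_mono[of i k n u] arrival_mono[of j k n u] assms by auto
  note v = arrival_value[OF assms(2) le(1)] arrival_value[OF assms(3) le(2)]
  have "state u n ! (i - 1) \<le> state u n ! (j - 1)"
    using consistent_state[of u n] v assms unfolding consistent_def by auto
  then show ?thesis using v assms by simp
qed

text \<open>
  The first component of \<open>\<omega>\<close> holds \<open>n\<close> letters, as real numbers, and the second one is the host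
  permutation. At time \<open>t\<close> the letter of rank \<open>\<sigma> t\<close> is shown.
\<close>

definition stream :: "nat \<Rightarrow> (nat \<Rightarrow> real) \<times> (nat \<Rightarrow> nat) \<Rightarrow> nat \<Rightarrow> nat" where
  "stream n \<omega> t = nat \<lfloor>fst \<omega> (sorting n (fst \<omega>) (snd \<omega> t))\<rfloor>"

text \<open>
  Ties between letters are harmless, since only strict inequalities between letters are used.
\<close>

lemma stream_order:
  assumes "snd \<omega> permutes {1..n}" "s \<in> {1..n}" "t \<in> {1..n}" "stream n \<omega> s < stream n \<omega> t"
  shows "snd \<omega> s < snd \<omega> t"
proof (rule ccontr)
  assume "\<not> ?thesis"
  moreover have "snd \<omega> s \<in> {1..n}" "snd \<omega> t \<in> {1..n}"
    using permutes_in_image[OF assms(1)] assms(2,3) by auto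
  ultimately have "fst \<omega> (sorting n (fst \<omega>) (snd \<omega> t)) \<le> fst \<omega> (sorting n (fst \<omega>) (snd \<omega> s))"
    using sorting[of n "fst \<omega>"] by auto
  then have "stream n \<omega> t \<le> stream n \<omega> s" unfolding stream_def by (intro nat_mono floor_mono)
  then show False using assms by simp
qed

definition host_space :: "nat \<Rightarrow> ((nat \<Rightarrow> real) \<times> (nat \<Rightarrow> nat)) set" where
  "host_space n = ({1..n} \<rightarrow>\<^sub>E real ` {1..q+k}) \<times> {\<pi>. \<pi> permutes {1..n}}"

lemma perm_stream_embedding_arrival:
  "perm_stream_embedding (uniform_count_measure (host_space n)) fst snd n k p
     (\<lambda>i \<omega>. arrival n (stream n \<omega>) i)"
  unfolding perm_stream_embedding_def
proof (intro conjI ballI)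
  let ?M = "uniform_count_measure (host_space n)"
  fix i assume i: "i \<in> {1..k}"
  show "stopping_time (host_filtration ?M fst snd n) (\<lambda>\<omega>. arrival n (stream n \<omega>) i)"
  proof
    fix t
    let ?F = "host_filtration ?M fst snd n t"
    have sp: "space ?F = host_space n" unfolding host_filtration_def
      by (subst space_measure_of) (auto simp: space_uniform_count_measure)
    have "{\<omega>\<in>host_space n. arrival n (stream n \<omega>) i \<le> t} \<in> sets ?F"
    proof (cases "t \<le> n")
      case True
      have fin: "finite ({1..n} \<rightarrow>\<^sub>E real ` {1..q+k})" by (intro finite_PiE) auto
      show ?thesis unfolding host_space_def
      proof (rule host_filtration_sets[OF fin True])
        fix \<omega> \<omega>' assume w: "\<omega> \<in> {\<omega> \<in> ({1..n} \<rightarrow>\<^sub>E real ` {1..q+k}) \<times> {\<pi>. \<pi> permutes {1..n}}. arrival n (stream n \<omega>) i \<le> t}"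
          "\<omega>' \<in> ({1..n} \<rightarrow>\<^sub>E real ` {1..q+k}) \<times> {\<pi>. \<pi> permutes {1..n}}"
          "fst \<omega>' = fst \<omega>" "\<And>s. s \<in> {1..t} \<Longrightarrow> snd \<omega>' s = snd \<omega> s"
        have "state (stream n \<omega>') t = state (stream n \<omega>) t"
          by (rule state_cong) (simp only: stream_def w)
        then show "\<omega>' \<in> {\<omega> \<in> ({1..n} \<rightarrow>\<^sub>E real ` {1..q+k}) \<times> {\<pi>. \<pi> permutes {1..n}}. arrival n (stream n \<omega>) i \<le> t}"
          using w(1,2) arrival_le_iff[OF True, of i] i by auto
      qed blast
    next
      case False
      then have "arrival n (stream n \<omega>) i \<le> t" for \<omega> using arrival_le[of n "stream n \<omega>" i] by simp
      then have "{\<omega>\<in>host_space n. arrival n (stream n \<omega>) i \<le> t} = space ?F" unfolding sp by simp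
      then show ?thesis by (simp only: sets.top)
    qed
    then show "Measurable.pred ?F (\<lambda>\<omega>. arrival n (stream n \<omega>) i \<le> t)"
      by (simp add: pred_def sp)
  qed
next
  fix \<omega> assume "\<omega> \<in> space (uniform_count_measure (host_space n))"
  then have perm': "snd \<omega> permutes {1..n}" by (auto simp: space_uniform_count_measure host_space_def)
  let ?a = "arrival n (stream n \<omega>)"
  show "1 \<le> ?a 1" by (simp add: arrival_def)
  show "?a i \<le> ?a (Suc i)" for i by (rule arrival_mono) simp
  show "?a k \<le> n + 1" using arrival_le[of n _ k] by simp
  show "?a k = n + 1 \<or> order_isomorphic k p (\<lambda>j. snd \<omega> (?a j))"
  proof (cases "?a k = n + 1")
    case False
    then have ak: "?a k \<le> n" using arrival_le[of n "stream n \<omega>" k] by simp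
    have less: "snd \<omega> (?a i) < snd \<omega> (?a j)" if "i \<in> {1..k}" "j \<in> {1..k}" "p i < p j" for i j
    proof (rule stream_order[OF perm'])
      show "?a i \<in> {1..n}" "?a j \<in> {1..n}"
        using arrival_mono[of i k n "stream n \<omega>"] arrival_mono[of j k n "stream n \<omega>"] that ak
        by (auto simp: arrival_def)
      show "stream n \<omega> (?a i) < stream n \<omega> (?a j)" by (rule arrival_order[OF ak that])
    qed
    have "order_isomorphic k p (\<lambda>j. snd \<omega> (?a j))"
      unfolding order_isomorphic_def
    proof (intro ballI iffI)
      fix i j assume ij: "i \<in> {1..k}" "j \<in> {1..k}"
      show "p i < p j \<Longrightarrow> snd \<omega> (?a i) < snd \<omega> (?a j)" by (rule less[OF ij])
      assume lt: "snd \<omega> (?a i) < snd \<omega> (?a j)"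
      then have "i \<noteq> j" by auto
      then have "p i \<noteq> p j" using permutes_inj[OF perm] by (auto dest: injD)
      moreover have "\<not> p j < p i" using less[OF ij(2,1)] lt by auto
      ultimately show "p i < p j" by simp
    qed
    then show ?thesis ..
  qed simp
qed

lemma success_probability:
  "measure (uniform_count_measure (host_space n)) {\<omega>\<in>host_space n. arrival n (stream n \<omega>) k \<le> n}
    = 1 - fail n []"
proof -
  let ?S = "{1..n} \<rightarrow>\<^sub>E real ` {1..q+k}" and ?P = "{\<pi>. \<pi> permutes {1..n}}"
  let ?fails = "\<lambda>f. length (state (\<lambda>t. nat \<lfloor>f t :: real\<rfloor>) n) < k"
  let ?succ = "{\<omega>\<in>host_space n. arrival n (stream n \<omega>) k \<le> n}"
  have card_fun: "card {U\<in>?S. ?fails U} = fail n [] * N ^ n"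
  proof -
    let ?L = "{us. length us = n \<and> set us \<subseteq> {1..q+k} \<and> length (foldl step [] us) < k}"
    let ?f = "\<lambda>us. restrict (\<lambda>i. real (us ! (i - 1))) {1..n}"
    let ?g = "\<lambda>U. map (\<lambda>t. nat \<lfloor>U t :: real\<rfloor>) [1..<Suc n]"
    have gf: "?g (?f us) = us" if "length us = n" for us
      using that by (intro nth_equalityI) (auto simp del: upt_Suc)
    have "bij_betw ?f ?L {U\<in>?S. ?fails U}"
    proof (rule bij_betw_byWitness[where f' = ?g])
      show "\<forall>us\<in>?L. ?g (?f us) = us" using gf by blast
      show "\<forall>U\<in>{U\<in>?S. ?fails U}. ?f (?g U) = U"
      proof
        fix U assume "U \<in> {U\<in>?S. ?fails U}"
        then have U: "U \<in> ?S" by blast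
        show "?f (?g U) = U"
        proof
          fix t show "?f (?g U) t = U t"
          proof (cases "t \<in> {1..n}")
            case True
            then have "U t \<in> real ` {1..q+k}" using U by blast
            then obtain m where "U t = real m" by blast
            moreover have "t - 1 < length [1..<Suc n]" "[1..<Suc n] ! (t - 1) = t"
              using True by (auto simp del: upt_Suc)
            ultimately show ?thesis using True by (simp only: restrict_apply if_True nth_map floor_of_nat nat_int)
          next
            case False
            then show ?thesis using PiE_arb[OF U False] by (simp only: restrict_apply if_False)
          qed
        qed
      qed
      have run: "state (\<lambda>t. nat \<lfloor>U t\<rfloor>) n = foldl step [] (?g U)" for U :: "nat \<Rightarrow> real"
        by (simp only: state_def)
      show "?f ` ?L \<subseteq> {U\<in>?S. ?fails U}"
      proof (rule image_subsetI)
        fix us assume "us \<in> ?L"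
        then have us: "length us = n" "set us \<subseteq> {1..q+k}" "length (foldl step [] us) < k" by blast+
        have "us ! (i - 1) \<in> {1..q+k}" if "i \<in> {1..n}" for i
        proof -
          have "us ! (i - 1) \<in> set us" using us(1) that by (intro nth_mem) auto
          then show ?thesis using us(2) by blast
        qed
        then have "?f us \<in> ?S" unfolding restrict_PiE_iff by blast
        moreover have "?fails (?f us)" using us(3) unfolding run gf[OF us(1)] .
        ultimately show "?f us \<in> {U\<in>?S. ?fails U}" by blast
      qed
      show "?g ` {U\<in>?S. ?fails U} \<subseteq> ?L"
      proof (rule image_subsetI)
        fix U assume "U \<in> {U\<in>?S. ?fails U}"
        then have U: "U \<in> ?S" and f: "length (foldl step [] (?g U)) < k" unfolding run by blast+
        have "nat \<lfloor>U t\<rfloor> \<in> {1..q+k}" if "t \<in> {1..n}" for t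
        proof -
          have "U t \<in> real ` {1..q+k}" using U that by blast
          then show ?thesis by auto
        qed
        moreover have "set [1..<Suc n] = {1..n}" by auto
        ultimately have "set (?g U) \<subseteq> {1..q+k}" unfolding set_map by blast
        moreover have "length (?g U) = n" by simp
        ultimately show "?g U \<in> ?L" using f by blast
      qed
    qed
    then have "card {U\<in>?S. ?fails U} = card ?L" by (rule bij_betw_same_card[symmetric])
    then show ?thesis using card_failing_streams[of n "[]"] by simp
  qed
  have fin: "finite ?P" "finite (host_space n)"
    unfolding host_space_def by (auto intro!: finite_PiE finite_cartesian_product simp: finite_permutations)
  have "id \<in> ?P" by (simp add: permutes_id)
  then have Ppos: "card ?P > 0" using fin(1) card_gt_0_iff by blast
  have "card ?S = (q + k) ^ n" by (simp add: card_PiE card_image inj_on_def)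
  then have card_host: "real (card (host_space n)) = N ^ n * card ?P"
    by (simp add: host_space_def card_cartesian_product)
  have "host_space n - ?succ = {\<omega>\<in>?S \<times> ?P. ?fails (\<lambda>t. fst \<omega> (sorting n (fst \<omega>) (snd \<omega> t)))}"
    unfolding host_space_def using arrival_le_iff[of n n k] k1
    by (auto simp: not_le stream_def[abs_def])
  moreover have "card {\<omega>\<in>?S \<times> ?P. ?fails (\<lambda>t. fst \<omega> (sorting n (fst \<omega>) (snd \<omega> t)))}
      = card ?P * card {U\<in>?S. ?fails U}"
  proof (rule card_exchangeable)
    fix f g :: "nat \<Rightarrow> real" assume "\<And>t. t \<in> {1..n} \<Longrightarrow> f t = g t"
    then have "state (\<lambda>t. nat \<lfloor>f t\<rfloor>) n = state (\<lambda>t. nat \<lfloor>g t\<rfloor>) n" by (intro state_cong) simp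
    then show "?fails f = ?fails g" by simp
  qed (use sorting in auto)
  ultimately have "real (card (host_space n - ?succ)) = card ?P * (fail n [] * N ^ n)"
    using card_fun by simp
  moreover have "card (host_space n - ?succ) = card (host_space n) - card ?succ"
    using fin by (intro card_Diff_subset) auto
  moreover have "card ?succ \<le> card (host_space n)" using fin by (intro card_mono) auto
  ultimately have "real (card ?succ) = N ^ n * card ?P * (1 - fail n [])"
    using card_host by (simp add: of_nat_diff algebra_simps)
  then show ?thesis
    using card_host N_pos Ppos fin by (subst measure_uniform_count_measure) auto
qed

lemma beta_hat_le:
  assumes "fail n [] \<le> 1 / 2"
  shows "beta_hat k p \<le> n"
  unfolding beta_hat_def
proof (rule Least_le, intro exI conjI)
  show "random_host (uniform_count_measure (host_space n)) fst snd n"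
    unfolding host_space_def
    by (rule random_host_product) (use k1 in \<open>auto intro!: finite_PiE simp: PiE_eq_empty_iff\<close>)
  show "perm_stream_embedding (uniform_count_measure (host_space n)) fst snd n k p
     (\<lambda>i \<omega>. arrival n (stream n \<omega>) i)"
    by (rule perm_stream_embedding_arrival)
  show "1 / 2 \<le> measure (uniform_count_measure (host_space n))
     {\<omega> \<in> space (uniform_count_measure (host_space n)). arrival n (stream n \<omega>) k \<le> n}"
    unfolding space_uniform_count_measure success_probability using assms by simp
qed


section \<open>Comparison of the two quantities\<close>

lemma cost_le_beta: "ennreal (cost []) \<le> ennreal (N / q) * beta k p"
proof -
  have inv: "ennreal (N / q) * (ennreal (q / N) * x) = x" "ennreal (q / N) * (ennreal (N / q) * x) = x" for x
    using N_pos q1 by (simp_all flip: mult.assoc ennreal_mult)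
  have "ennreal (q / N) * ennreal (cost []) \<le> beta k p"
    unfolding beta_def
  proof (rule INF_greatest)
    fix \<tau> assume "\<tau> \<in> OA uniform_seq_space uniform_seq k p"
    from mult_left_mono[OF cost_le_online_time[OF this], of "ennreal (q / N)"]
    show "ennreal (q / N) * ennreal (cost [])
        \<le> (\<integral>\<^sup>+\<omega>. ennreal_of_enat (\<tau> k \<omega>) \<partial>uniform_seq_space)"
      unfolding inv by simp
  qed
  from mult_left_mono[OF this, of "ennreal (N / q)"] show ?thesis unfolding inv by simp
qed

text \<open>
  With \<open>s = sqrt (2 * N * cost [])\<close> the overshoot \<open>x \<ge> s + 2 * N\<close> satisfies
  \<open>x * (x - 2 * N) \<ge> (s + 2 * N) * s \<ge> 2 * N * cost []\<close>, which is the condition of \<open>fail_le_half\<close>.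
\<close>

lemma beta_hat_le_cost: "beta_hat k p \<le> cost [] + sqrt (2 * N * cost []) + 2 * N + 1"
proof -
  let ?c = "cost []"
  define s where "s = sqrt (2 * N * ?c)"
  define n where "n = nat \<lceil>?c + s + 2 * N\<rceil>"
  have c: "?c \<ge> 0" using cost_bounds[of "[]"] by simp
  then have s: "s \<ge> 0" "s\<^sup>2 = 2 * N * ?c" by (simp_all add: s_def)
  have n: "?c + s + 2 * N \<le> n" "n \<le> ?c + s + 2 * N + 1"
    using c s N_pos unfolding n_def by linarith+
  have "fail n [] \<le> 1 / 2"
  proof (rule fail_le_half)
    show "?c \<le> n" using n s N_pos by linarith
    have "0 < ?c + s + 2 * N" using c s(1) N_pos by (intro add_nonneg_pos) auto
    also have "\<dots> \<le> n" by (rule n(1))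
    finally show "n > 0" by simp
    have "2 * N * ?c \<le> (s + 2 * N) * s" using s N_pos by (simp add: power2_eq_square distrib_right)
    also have "\<dots> \<le> (n - ?c) * (n - ?c - 2 * N)"
      using n s N_pos by (intro mult_mono) auto
    finally show "2 * N * n \<le> (n - ?c)\<^sup>2" by (simp add: power2_eq_square algebra_simps)
  qed
  then have "real (beta_hat k p) \<le> n" using beta_hat_le by simp
  then show ?thesis using n unfolding s_def by linarith
qed

lemma beta_hat_le_beta:
  "ennreal (beta_hat k p)
    \<le> ennreal ((1 + sqrt (72 * N / (real k)\<^sup>2) + 36 * (2 * N + 1) / (real k)\<^sup>2) * (N / q)) * beta k p"
proof -
  let ?c = "cost []"
  have c: "(real k)\<^sup>2 / 36 \<le> ?c" by (rule cost_Nil_ge)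
  have k: "(real k)\<^sup>2 / 36 > 0" using k1 by simp
  then have cpos: "?c > 0" using c by linarith
  let ?\<delta> = "sqrt (72 * N / (real k)\<^sup>2) + 36 * (2 * N + 1) / (real k)\<^sup>2"
  have sq: "sqrt (?c\<^sup>2 * y) = ?c * sqrt y" for y using cpos by (simp add: real_sqrt_mult)
  have "2 * N * ?c = ?c\<^sup>2 * (2 * N / ?c)" using cpos by (simp add: power2_eq_square)
  then have "sqrt (2 * N * ?c) = ?c * sqrt (2 * N / ?c)" by (simp only: sq)
  also have "2 * N / ?c \<le> 2 * N / ((real k)\<^sup>2 / 36)"
    using c k cpos by (intro divide_left_mono mult_pos_pos) auto
  then have "?c * sqrt (2 * N / ?c) \<le> ?c * sqrt (72 * N / (real k)\<^sup>2)"
    using cpos by (intro mult_left_mono real_sqrt_le_mono) auto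
  finally have 1: "sqrt (2 * N * ?c) \<le> ?c * sqrt (72 * N / (real k)\<^sup>2)" .
  have "2 * N + 1 = ?c * ((2 * N + 1) / ?c)" using cpos by simp
  also have "\<dots> \<le> ?c * ((2 * N + 1) / ((real k)\<^sup>2 / 36))"
    using c k cpos N_pos by (intro mult_left_mono divide_left_mono) auto
  finally have 2: "2 * N + 1 \<le> ?c * (36 * (2 * N + 1) / (real k)\<^sup>2)" by (simp add: mult.commute)
  have "real (beta_hat k p) \<le> (1 + ?\<delta>) * ?c"
    using beta_hat_le_cost 1 2 by (simp add: algebra_simps)
  then have "ennreal (beta_hat k p) \<le> ennreal (1 + ?\<delta>) * ennreal ?c"
    using N_pos cpos by (subst ennreal_mult[symmetric]) (auto intro!: ennreal_leI add_nonneg_nonneg)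
  also have "\<dots> \<le> ennreal (1 + ?\<delta>) * (ennreal (N / q) * beta k p)"
    by (intro mult_left_mono cost_le_beta) simp
  also have "\<dots> = ennreal ((1 + ?\<delta>) * (N / q)) * beta k p"
    using N_pos by (subst ennreal_mult) (auto intro!: add_nonneg_nonneg simp: mult.assoc)
  finally show ?thesis by (simp add: add.assoc)
qed

end

theorem proposition1p15:
  shows "\<exists>\<epsilon> :: nat \<Rightarrow> real. \<epsilon> \<longlonglongrightarrow> 0 \<and>
    (\<forall>k\<ge>1. \<forall>p. p permutes {1..k} \<longrightarrow>
       ennreal (real (beta_hat k p)) \<le> ennreal (1 + \<epsilon> k) * beta k p)"
proof -
  let ?M = "\<lambda>k::nat. real k * (sqrt k + 2)"
  define \<epsilon> where "\<epsilon> k = (1 + sqrt (72 * ?M k / (real k)\<^sup>2) + 36 * (2 * ?M k + 1) / (real k)\<^sup>2) *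
      (1 + 1 / sqrt k) - 1" for k :: nat
  have "\<epsilon> \<longlonglongrightarrow> 0" unfolding \<epsilon>_def by real_asymp
  moreover have "ennreal (real (beta_hat k p)) \<le> ennreal (1 + \<epsilon> k) * beta k p"
    if k: "k \<ge> 1" and p: "p permutes {1..k}" for k p
  proof -
    \<comment> \<open>The number \<open>q\<close> of cells must grow faster than \<open>k\<close>, for \<open>N / q\<close> to tend to \<open>1\<close>, and slower than \<open>k\<^sup>2\<close>, for concentration.\<close>
    define m where "m = nat \<lceil>sqrt k\<rceil>"
    define q where "q = k * m"
    have m: "sqrt k \<le> m" "m \<le> sqrt k + 1" unfolding m_def by auto
    have sk: "sqrt k \<ge> 1" using k by simp
    then have "m \<ge> 1" using m by linarith
    interpret cell_game p k q
      by unfold_locales (use k p \<open>m \<ge> 1\<close> in \<open>auto simp: q_def Suc_le_eq\<close>)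
    have N: "N \<le> ?M k"
      using m mult_left_mono[of "m + 1" "sqrt k + 2" "real k"] unfolding q_def by (simp add: algebra_simps)
    have "N / q = 1 + 1 / m" using k \<open>m \<ge> 1\<close> unfolding q_def by (simp add: field_simps)
    also have "\<dots> \<le> 1 + 1 / sqrt k"
      using m sk \<open>m \<ge> 1\<close> by (intro add_left_mono divide_left_mono mult_pos_pos) linarith+
    finally have r: "N / q \<le> 1 + 1 / sqrt k" .
    have "(1 + sqrt (72 * N / (real k)\<^sup>2) + 36 * (2 * N + 1) / (real k)\<^sup>2) * (N / q) \<le> 1 + \<epsilon> k"
    proof -
      have "1 + \<epsilon> k = (1 + sqrt (72 * ?M k / (real k)\<^sup>2) + 36 * (2 * ?M k + 1) / (real k)\<^sup>2) * (1 + 1 / sqrt k)"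
        by (simp add: \<epsilon>_def)
      then show ?thesis using N r
        by (simp only:) (intro mult_mono add_mono divide_right_mono real_sqrt_le_mono mult_left_mono add_nonneg_nonneg; simp)
    qed
    then show ?thesis
      using beta_hat_le_beta by (meson ennreal_leI mult_right_mono order_trans zero_le)
  qed
  ultimately show ?thesis by blast
qed

end
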